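(* There is a constant $C>0$, independent of the mesh size $h$, of the location of the interface $\Gamma$ relative to the mesh, and of $\beta^\pm$, such that for each interface element $T\in\mathcal{T}_h^i$ and each face $F$ of $T$ (with unit normal $\mathbf{n}$), one of the following two trace inequalities must hold for all $\phi_T\in S_h(T)$: \begin{align*} \text{(a)}\quad & \|\nabla\phi_T\cdot\mathbf{n}\|_{L^2(F)}\le C h^{-1/2}\|\nabla\phi_T\|_{L^2(T)},\\ \text{(b)}\quad & \|\beta\nabla\phi_T\cdot\mathbf{n}\|_{L^2(F)}\le C h^{-1/2}\|\beta\nabla\phi_T\|_{L^2(T)}. \end{align*}
   Context: Setting and mesh: $\Omega\subset\mathbb{R}^3$ is an open cuboid domain, separated into two subdomains $\Omega^-$ and $\Omega^+$ by a closed $C^2$ surface $\Gamma\subset\Omega$ (the interface). The coefficient $\beta$ is piecewise constant, $\beta=\beta^\pm>0$ in $\Omega^\pm$, with the convention that $\beta^+$ is the larger and $\beta^-$ the smaller coefficient. $\kappa$ is the maximal (principal) curvature of $\Gamma$, and $r_\Gamma$ (the reach) is the largest $r$ such that the segments $N_X(r)$, $X\in\Gamma$, of length $2r$, centered at $X$ and perpendicular to $\Gamma$, are pairwise disjoint. $\mathcal{T}_h$ is a Cartesian mesh of $\Omega$ consisting of cuboids, where $h$ denotes the maximum length of all the cuboids. An element is an interface element if its vertices do not all lie on the same side of $\Gamma$; $\mathcal{T}_h^i$ is the set of interface elements. Standing assumptions: $h<r_\Gamma/(3\sqrt3)$; $h\kappa\le 0.0288$; $\Gamma$ cannot intersect a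 mesh edge at more than one point; $\Gamma$ cannot intersect a mesh face at more than two edges. Approximate plane: for each $T\in\mathcal{T}_h^i$, fix a triangle whose vertices are three of the intersection points of $\Gamma$ with the edges of $T$ and whose maximal angle is at most $135^\circ$ (such a triangle always exists). $\tau_T$ is the plane containing it, $\bar{\mathbf{n}}$ a unit normal to $\tau_T$, and $F_T$ the centroid of the triangle. Put $L(X)=(X-F_T)\cdot\bar{\mathbf{n}}$. Trilinear IFE space: $\mathbb{Q}_1=\mathrm{Span}\{1,x,y,z,xy,xz,yz,xyz\}$, $T^\pm=T\cap\Omega^\pm$, and $\mathcal{C}_T:\mathbb{Q}_1\to\mathbb{Q}_1$, $\mathcal{C}_T(p)=p+\left(\frac{\beta^-}{\beta^+}-1\right)(\nabla p(F_T)\cdot\bar{\mathbf{n}})L$. The local space $S_h(T)$ consists of the functions $\phi_T$ with $\phi_T|_{T^-}=p$ and $\phi_T|_{T^+}=\mathcal{C}_T(p)$ for some $p\in\mathbb{Q}_1$. The gradient $\nabla\phi_T$ is taken piecewise on $T^\pm$ (and correspondingly on $F\cap T^{\pm}$).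
   Formalization: The meshes are assumed quasi-uniform: h is at most σ times every edge length of every cuboid, for an arbitrary fixed σ ≥ 1, and C depends only on σ; without such a bound the inequalities fail on thin cuboids. *)

theory Defs
  imports "HOL-Analysis.Analysis"
begin

section \<open>Closed surfaces of class \<open>C\<^sup>2\<close>\<close>

text \<open>\<open>g\<close> is a local \<open>C\<^sup>2\<close> defining function of \<open>\<Gamma>\<close> on the open set \<open>U\<close>, with
  nowhere vanishing gradient \<open>G\<close> and continuous Hessian \<open>H\<close>.\<close>

definition C2_defining ::
  "(real^3) set \<Rightarrow> (real^3) set \<Rightarrow> (real^3 \<Rightarrow> real) \<Rightarrow> (real^3 \<Rightarrow> real^3) \<Rightarrow> bool" where
  "C2_defining \<Gamma> U g G \<longleftrightarrow>
     open U \<and> \<Gamma> \<inter> U = {x \<in> U. g x = 0} \<and>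
     (\<forall>x\<in>U. (GDERIV g x :> G x) \<and> G x \<noteq> 0) \<and>
     (\<exists>H :: real^3 \<Rightarrow> real^3^3. continuous_on U H \<and>
        (\<forall>x\<in>U. (G has_derivative (\<lambda>v. H x *v v)) (at x)))"

definition closed_C2_surface :: "(real^3) set \<Rightarrow> bool" where
  "closed_C2_surface \<Gamma> \<longleftrightarrow>
     compact \<Gamma> \<and> \<Gamma> \<noteq> {} \<and> (\<forall>X\<in>\<Gamma>. \<exists>U g G. C2_defining \<Gamma> U g G \<and> X \<in> U)"

text \<open>Both orientations of the normal are included, as \<open>g\<close> may be replaced by \<open>-g\<close>.\<close>

definition surface_normal :: "(real^3) set \<Rightarrow> real^3 \<Rightarrow> real^3 \<Rightarrow> bool" where
  "surface_normal \<Gamma> X n \<longleftrightarrow>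
     X \<in> \<Gamma> \<and> (\<exists>U g G. C2_defining \<Gamma> U g G \<and> X \<in> U \<and> n = sgn (G X))"

text \<open>Principal curvatures are the eigenvalues of the shape operator, i.e. of the derivative of
  the unit normal field \<open>sgn \<circ> G\<close> restricted to the tangent plane. Their sign depends on the
  orientation, hence the absolute value in the maximal curvature.\<close>

definition principal_curvature :: "(real^3) set \<Rightarrow> real^3 \<Rightarrow> real \<Rightarrow> bool" where
  "principal_curvature \<Gamma> X k \<longleftrightarrow>
     X \<in> \<Gamma> \<and> (\<exists>U g G D v. C2_defining \<Gamma> U g G \<and> X \<in> U \<and>
       ((\<lambda>x. sgn (G x)) has_derivative D) (at X) \<and>
       v \<noteq> 0 \<and> v \<bullet> G X = 0 \<and> D v = k *\<^sub>R v)"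

definition max_curvature :: "(real^3) set \<Rightarrow> real" where
  "max_curvature \<Gamma> = Sup {\<bar>k\<bar> | k X. principal_curvature \<Gamma> X k}"

definition normal_segment :: "(real^3) set \<Rightarrow> real \<Rightarrow> real^3 \<Rightarrow> (real^3) set" where
  "normal_segment \<Gamma> r X = {X + t *\<^sub>R n | t n. surface_normal \<Gamma> X n \<and> \<bar>t\<bar> \<le> r}"

text \<open>A supremum, because with closed segments the largest radius is not attained
  (for a sphere, all segments meet in the centre as soon as \<open>r\<close> equals its radius).\<close>

definition surface_reach :: "(real^3) set \<Rightarrow> real" where
  "surface_reach \<Gamma> = Sup {r. 0 < r \<and> disjoint_family_on (normal_segment \<Gamma> r) \<Gamma>}"

definition separates ::
  "(real^3) set \<Rightarrow> (real^3) set \<Rightarrow> (real^3) set \<Rightarrow> (real^3) set \<Rightarrow> bool" where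
  "separates \<Gamma> \<Omega> \<Omega>m \<Omega>p \<longleftrightarrow>
     \<Gamma> \<subseteq> \<Omega> \<and> open \<Omega>m \<and> open \<Omega>p \<and> connected \<Omega>m \<and> connected \<Omega>p \<and>
     \<Omega>m \<noteq> {} \<and> \<Omega>p \<noteq> {} \<and> \<Omega>m \<inter> \<Omega>p = {} \<and> \<Omega>m \<union> \<Omega>p = \<Omega> - \<Gamma>"


section \<open>Cartesian meshes\<close>

text \<open>A cuboid is represented by its two extreme corners \<open>(l, u)\<close>.\<close>

type_synonym cuboid = "(real^3) \<times> (real^3)"

definition cartesian_mesh :: "real^3 \<Rightarrow> real^3 \<Rightarrow> cuboid set \<Rightarrow> bool" where
  "cartesian_mesh a b \<T> \<longleftrightarrow>
     (\<exists>(N :: 3 \<Rightarrow> nat) (x :: 3 \<Rightarrow> nat \<Rightarrow> real).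
        (\<forall>i. x i 0 = a $ i \<and> x i (N i) = b $ i \<and> (\<forall>k < N i. x i k < x i (Suc k))) \<and>
        \<T> = {(\<chi> i. x i (k i), \<chi> i. x i (Suc (k i))) | k. \<forall>i. k i < N i})"

definition mesh_size :: "cuboid set \<Rightarrow> real" where
  "mesh_size \<T> = Max {u $ i - l $ i | l u i. (l, u) \<in> \<T>}"

definition element :: "cuboid \<Rightarrow> (real^3) set" where
  "element T = cbox (fst T) (snd T)"

definition element_vertices :: "cuboid \<Rightarrow> (real^3) set" where
  "element_vertices T = {v. \<forall>i. v $ i \<in> {fst T $ i, snd T $ i}}"

definition element_edges :: "cuboid \<Rightarrow> (real^3) set set" where
  "element_edges T =
     {closed_segment v w | v w i. v \<in> element_vertices T \<and> w \<in> element_vertices T \<and>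
        v $ i \<noteq> w $ i \<and> (\<forall>j. j \<noteq> i \<longrightarrow> v $ j = w $ j)}"

definition face_indices :: "cuboid \<Rightarrow> (3 \<times> real) set" where
  "face_indices T = {(i, c). c \<in> {fst T $ i, snd T $ i}}"

definition face :: "cuboid \<Rightarrow> 3 \<Rightarrow> real \<Rightarrow> (real^3) set" where
  "face T i c = {x \<in> element T. x $ i = c}"

definition face_edges :: "cuboid \<Rightarrow> 3 \<Rightarrow> real \<Rightarrow> (real^3) set set" where
  "face_edges T i c = {e \<in> element_edges T. e \<subseteq> face T i c}"

text \<open>Two-dimensional Lebesgue measure on the plane where the \<open>i\<close>-th coordinate equals \<open>c\<close>.\<close>

definition plane_measure :: "3 \<Rightarrow> real \<Rightarrow> (real^3) measure" where
  "plane_measure i c =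
     distr (Pi\<^sub>M (UNIV - {i}) (\<lambda>_. lborel)) borel (\<lambda>y. \<chi> j. if j = i then c else y j)"

text \<open>The closed side of \<open>\<Gamma>\<close>, with \<open>S\<close> one of the two (open) subdomains. Inside \<open>\<Omega>\<close> it is \<open>S\<close>
  itself; the closure only adds the points of the boundary of \<open>\<Omega>\<close> adjacent to \<open>S\<close>, so that
  vertices and faces lying on the boundary of \<open>\<Omega>\<close> are assigned to a side as well.\<close>

definition side :: "(real^3) set \<Rightarrow> (real^3) set \<Rightarrow> (real^3) set" where
  "side \<Gamma> S = closure S - \<Gamma>"

definition subelement :: "(real^3) set \<Rightarrow> (real^3) set \<Rightarrow> cuboid \<Rightarrow> (real^3) set" where
  "subelement \<Gamma> S T = element T \<inter> side \<Gamma> S"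

definition interface_elements ::
  "(real^3) set \<Rightarrow> (real^3) set \<Rightarrow> (real^3) set \<Rightarrow> cuboid set \<Rightarrow> cuboid set" where
  "interface_elements \<Gamma> \<Omega>m \<Omega>p \<T> =
     {T \<in> \<T>. \<not> element_vertices T \<subseteq> side \<Gamma> \<Omega>m \<and> \<not> element_vertices T \<subseteq> side \<Gamma> \<Omega>p}"

definition edge_face_condition :: "(real^3) set \<Rightarrow> cuboid set \<Rightarrow> bool" where
  "edge_face_condition \<Gamma> \<T> \<longleftrightarrow>
     (\<forall>T\<in>\<T>. \<forall>e\<in>element_edges T. \<forall>x\<in>\<Gamma> \<inter> e. \<forall>y\<in>\<Gamma> \<inter> e. x = y) \<and>
     (\<forall>T\<in>\<T>. \<forall>(i, c)\<in>face_indices T. card {e \<in> face_edges T i c. \<Gamma> \<inter> e \<noteq> {}} \<le> 2)"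


section \<open>The approximate plane\<close>

definition angle_at :: "real^3 \<Rightarrow> real^3 \<Rightarrow> real^3 \<Rightarrow> real" where
  "angle_at P Q R = arccos ((Q - P) \<bullet> (R - P) / (norm (Q - P) * norm (R - P)))"

definition admissible_triangle ::
  "(real^3) set \<Rightarrow> cuboid \<Rightarrow> real^3 \<Rightarrow> real^3 \<Rightarrow> real^3 \<Rightarrow> bool" where
  "admissible_triangle \<Gamma> T P Q R \<longleftrightarrow>
     {P, Q, R} \<subseteq> \<Gamma> \<inter> \<Union>(element_edges T) \<and> \<not> collinear {P, Q, R} \<and>
     angle_at P Q R \<le> 3 * pi / 4 \<and> angle_at Q R P \<le> 3 * pi / 4 \<and> angle_at R P Q \<le> 3 * pi / 4"

definition centroid :: "real^3 \<Rightarrow> real^3 \<Rightarrow> real^3 \<Rightarrow> real^3" where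
  "centroid P Q R = (1 / 3) *\<^sub>R (P + Q + R)"

text \<open>Used for a planar set \<open>S\<close> that spans a plane.\<close>

definition unit_normal_to :: "(real^3) set \<Rightarrow> real^3 \<Rightarrow> bool" where
  "unit_normal_to S n \<longleftrightarrow> norm n = 1 \<and> (\<forall>x\<in>S. \<forall>y\<in>S. n \<bullet> (x - y) = 0)"


section \<open>The trilinear IFE space\<close>

definition Q1 :: "(real^3 \<Rightarrow> real) set" where
  "Q1 = {p. \<exists>c0 c1 c2 c3 c12 c13 c23 c123. p = (\<lambda>x.
     c0 + c1 * x$1 + c2 * x$2 + c3 * x$3 + c12 * x$1 * x$2 + c13 * x$1 * x$3 + c23 * x$2 * x$3 +
     c123 * x$1 * x$2 * x$3)}"

text \<open>Gradient relative to \<open>S\<close>; for \<open>x\<close> on the boundary of an element it is the one-sided one.\<close>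

definition grad_within :: "(real^3) set \<Rightarrow> (real^3 \<Rightarrow> real) \<Rightarrow> real^3 \<Rightarrow> real^3" where
  "grad_within S f x = (THE D. (f has_derivative (\<lambda>v. v \<bullet> D)) (at x within S))"

definition ife_extension ::
  "real \<Rightarrow> real \<Rightarrow> real^3 \<Rightarrow> real^3 \<Rightarrow> (real^3 \<Rightarrow> real) \<Rightarrow> real^3 \<Rightarrow> real" where
  "ife_extension \<beta>m \<beta>p F nb p =
     (\<lambda>x. p x + (\<beta>m / \<beta>p - 1) * (grad_within UNIV p F \<bullet> nb) * ((x - F) \<bullet> nb))"

text \<open>Functions are total in HOL; only the values on \<open>Tm\<close> and \<open>Tp\<close> matter.\<close>

definition ife_space ::
  "real \<Rightarrow> real \<Rightarrow> real^3 \<Rightarrow> real^3 \<Rightarrow> (real^3) set \<Rightarrow> (real^3) set \<Rightarrow> (real^3 \<Rightarrow> real) set" where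
  "ife_space \<beta>m \<beta>p F nb Tm Tp =
     {\<phi>. \<exists>p\<in>Q1. (\<forall>x\<in>Tm. \<phi> x = p x) \<and> (\<forall>x\<in>Tp. \<phi> x = ife_extension \<beta>m \<beta>p F nb p x)}"

text \<open>Off \<open>Tm \<union> Tp\<close>, i.e. on \<open>\<Gamma>\<close>, the piecewise gradient is set to zero, so that integrals
  of it only extend over \<open>Tm\<close> and \<open>Tp\<close>.\<close>

definition piecewise_grad ::
  "(real^3) set \<Rightarrow> (real^3) set \<Rightarrow> (real^3 \<Rightarrow> real) \<Rightarrow> real^3 \<Rightarrow> real^3" where
  "piecewise_grad Tm Tp \<phi> x =
     (if x \<in> Tm then grad_within Tm \<phi> x else if x \<in> Tp then grad_within Tp \<phi> x else 0)"

definition piecewise_const ::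
  "(real^3) set \<Rightarrow> (real^3) set \<Rightarrow> real \<Rightarrow> real \<Rightarrow> real^3 \<Rightarrow> real" where
  "piecewise_const Tm Tp \<beta>m \<beta>p x = (if x \<in> Tm then \<beta>m else if x \<in> Tp then \<beta>p else 0)"

definition L2_norm_on ::
  "(real^3) measure \<Rightarrow> (real^3) set \<Rightarrow> (real^3 \<Rightarrow> 'b :: real_normed_vector) \<Rightarrow> real" where
  "L2_norm_on M S f = sqrt (LINT x:S|M. (norm (f x))\<^sup>2)"

end

theory Submission
  imports Defs
begin

text \<open>
  The reason behind the alternative is that one of the two parts \<open>Tm\<close>, \<open>Tp\<close> of an element fills
  at least half of its volume, and that both traces of an IFE function are controlled by the
  polynomial that lives on the larger part.

  Let \<open>\<phi>\<close> be given by \<open>p\<close> on \<open>Tm\<close> and by its extension on \<open>Tp\<close>, put \<open>\<rho> = \<beta>m / \<beta>p \<in> {0<..1}\<close>, and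
  write \<open>q\<close> for the gradient of \<open>p\<close>. The gradient on \<open>Tp\<close> is
  \<open>q' x = q x + (\<rho> - 1) (q F \<bullet> nb) nb\<close>, so that \<open>\<bar>q' x\<bar> \<le> \<bar>q x\<bar> + \<bar>q F\<bar>\<close>: the passage from \<open>Tm\<close> to
  \<open>Tp\<close> is bounded uniformly in the coefficients. The passage back is not, since it involves \<open>1 / \<rho>\<close>.
  But \<open>q' F \<bullet> nb = \<rho> (q F \<bullet> nb)\<close>, and after multiplication by the coefficient the factor
  disappears: \<open>\<bar>\<beta>m q x\<bar> \<le> \<bar>\<beta>p q' x\<bar> + \<bar>\<beta>p q' F\<bar>\<close>. Hence (a) holds if \<open>Tm\<close> is the large part, (b) if \<open>Tp\<close>
  is, provided that a polynomial gradient \<open>Q\<close> satisfies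
  \<open>\<bar>Q v\<bar>\<^sup>2 \<le> (C / h^3) * (LINT x:E|lborel. \<bar>Q x\<bar>\<^sup>2)\<close> for every \<open>v\<close> in the element and every \<open>E\<close> filling half of the element; the
  area of a face, at most \<open>h\<^sup>2\<close>, then gives the factor \<open>1 / h\<close> between the squared norms. This is
  \<open>trace_inequality_from_large_part\<close>, and \<open>trace_alternative\<close> joins the two cases.

  The bound on \<open>Q\<close> is a Remez inequality (\<open>multiaffine_remez_L2\<close>). The components of \<open>Q\<close> are affine
  in each coordinate separately, and an affine function on an interval exceeds a small multiple
  of its value at a given point outside a short subinterval. Replacing the coordinates of \<open>v\<close> by those of
  \<open>x\<close> one after the other, and integrating over slices, shows that each component of
  \<open>Q x\<close> is at least a fixed multiple of that of \<open>Q v\<close>, in absolute value, outside a quarter of the element. Only the volume of \<open>E\<close> enters this argument,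
  which is why the constant does not depend on how the interface cuts the element.

  That one part fills half of the element follows because the two closed sides and \<open>\<Gamma>\<close> cover it and
  \<open>\<Gamma>\<close> has measure zero (\<open>negligible_closed_C2_surface\<close>). Moreover each part is relatively open in the
  element, so the one-sided gradients in the definition of the piecewise gradient are unique, also at
  points of the boundary of the element, and equal the gradients of the two polynomials
  (\<open>ife_space_piecewise_grad\<close>).
\<close>

section \<open>Slicing Lebesgue measure along a coordinate\<close>

definition coord_update :: "real^'n \<Rightarrow> 'n \<Rightarrow> real \<Rightarrow> real^'n" where
  "coord_update x i t = (\<chi> j. if j = i then t else x $ j)"

lemma borel_measurable_vec_lambdaI:
  fixes f :: "'a \<Rightarrow> 'n::finite \<Rightarrow> real"
  assumes "\<And>j. (\<lambda>x. f x j) \<in> borel_measurable M"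
  shows "(\<lambda>x. \<chi> j. f x j) \<in> borel_measurable M"
proof (subst borel_measurable_euclidean_space, rule ballI)
  fix b :: "real^'n" assume "b \<in> Basis"
  then obtain k where b: "b = axis k 1" by (auto simp: Basis_vec_def)
  show "(\<lambda>x. (\<chi> j. f x j) \<bullet> b) \<in> borel_measurable M"
    using assms[of k] unfolding b by (simp add: inner_axis)
qed

lemma content_cbox_prod:
  fixes l u :: "real^'n"
  assumes "\<And>k. l $ k \<le> u $ k"
  shows "measure lborel (cbox l u) = (\<Prod>k\<in>UNIV. u $ k - l $ k)"
proof -
  have "cbox l u \<noteq> {}" using assms by (simp add: interval_ne_empty_cart)
  then show ?thesis by (rule content_cbox_cart)
qed

text \<open>Presents Lebesgue measure on vectors as a product measure, which makes Fubini's theorem available for a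
  single coordinate.\<close>
lemma lborel_eq_PiM:
  "(lborel :: (real^'n) measure) = distr (Pi\<^sub>M UNIV (\<lambda>_. lborel)) borel (\<lambda>y. \<chi> j. y j)"
proof (rule lborel_eqI)
  interpret product_sigma_finite "\<lambda>_::'n. lborel :: real measure" by standard
  fix l u :: "real^'n" assume "\<And>b. b \<in> Basis \<Longrightarrow> l \<bullet> b \<le> u \<bullet> b"
  then have le: "l $ k \<le> u $ k" for k
    by (metis axis_in_Basis_iff cart_eq_inner_axis Basis_real_def singletonI)
  have m: "(\<lambda>y. \<chi> j. y j) \<in> measurable (Pi\<^sub>M UNIV (\<lambda>_::'n. lborel :: real measure)) borel"
    by (rule borel_measurable_vec_lambdaI) measurable
  have pre: "(\<lambda>y. \<chi> j. y j) -` box l u \<inter> space (Pi\<^sub>M UNIV (\<lambda>_::'n. lborel :: real measure))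
      = Pi\<^sub>E UNIV (\<lambda>j. {l $ j <..< u $ j})"
    by (auto simp: space_PiM mem_box_cart PiE_def Pi_def)
  have "emeasure (distr (Pi\<^sub>M UNIV (\<lambda>_. lborel)) borel (\<lambda>y. \<chi> j. y j)) (box l u)
      = (\<Prod>k\<in>UNIV. ennreal (u $ k - l $ k))"
    using le by (subst emeasure_distr[OF m]) (auto simp: pre emeasure_PiM)
  also have "\<dots> = ennreal (\<Prod>k\<in>UNIV. u $ k - l $ k)"
    using le by (simp add: prod_ennreal)
  also have "(\<Prod>k\<in>UNIV. u $ k - l $ k) = (\<Prod>b\<in>Basis. (u - l) \<bullet> b)"
    by (simp add: Basis_vec_def cart_eq_inner_axis axis_eq_axis prod.UNION_disjoint inner_diff_left)
  finally show "emeasure (distr (Pi\<^sub>M UNIV (\<lambda>_. lborel)) borel (\<lambda>y. \<chi> j. y j)) (box l u)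
      = ennreal (\<Prod>b\<in>Basis. (u - l) \<bullet> b)" by simp
qed simp

lemma emeasure_le_by_slices:
  fixes S :: "(real^'n) set"
  assumes S: "S \<in> sets borel" "S \<subseteq> cbox l u" and le: "\<And>k. l $ k \<le> u $ k" and "0 \<le> \<epsilon>"
    and slice: "\<And>x. emeasure lborel {t. coord_update x i t \<in> S} \<le> ennreal (\<epsilon> * (u $ i - l $ i))"
  shows "emeasure lborel S \<le> ennreal (\<epsilon> * measure lborel (cbox l u))"
proof -
  interpret product_sigma_finite "\<lambda>_::'n. lborel :: real measure" by standard
  let ?J = "UNIV - {i}"
  let ?M = "\<lambda>I. Pi\<^sub>M I (\<lambda>_::'n. lborel :: real measure)"
  let ?B = "Pi\<^sub>E ?J (\<lambda>j. {l $ j .. u $ j})"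
  have U: "(UNIV :: 'n set) = insert i ?J" by auto
  have m: "(\<lambda>y. \<chi> j. y j) \<in> measurable (?M UNIV) borel"
    by (rule borel_measurable_vec_lambdaI) measurable
  have Bs: "?B \<in> sets (?M ?J)" by (rule sets_PiM_I_finite) auto
  have "emeasure lborel S = emeasure (distr (?M UNIV) borel (\<lambda>y. \<chi> j. y j)) S"
    by (subst lborel_eq_PiM) simp
  also have "\<dots> = (\<integral>\<^sup>+ y. indicator S y \<partial>distr (?M UNIV) borel (\<lambda>y. \<chi> j. y j))"
    using S by simp
  also have "\<dots> = (\<integral>\<^sup>+ y. indicator S (\<chi> j. y j) \<partial>?M UNIV)"
    using S by (subst nn_integral_distr[OF m]) auto
  also have "\<dots> = (\<integral>\<^sup>+ y. indicator S (\<chi> j. y j) \<partial>?M (insert i ?J))"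
    using U by simp
  also have "\<dots> = (\<integral>\<^sup>+ y. \<integral>\<^sup>+ t. indicator S (\<chi> j. (y(i := t)) j) \<partial>lborel \<partial>?M ?J)"
  proof (rule product_nn_integral_insert)
    have "(\<lambda>y. \<chi> j. y j) \<in> measurable (?M (insert i ?J)) borel" using m U by simp
    then show "(\<lambda>y. indicator S (\<chi> j. y j)) \<in> borel_measurable (?M (insert i ?J))"
      using S by measurable
  qed auto
  also have "\<dots> \<le> (\<integral>\<^sup>+ y. ennreal (\<epsilon> * (u $ i - l $ i)) * indicator ?B y \<partial>?M ?J)"
  proof (rule nn_integral_mono)
    fix y assume y: "y \<in> space (?M ?J)"
    have eq: "(\<chi> j. (y(i := t)) j) = coord_update (\<chi> j. y j) i t" for t
      by (simp add: coord_update_def vec_eq_iff)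
    have inn: "(\<integral>\<^sup>+ t. indicator S (\<chi> j. (y(i := t)) j) \<partial>lborel) = emeasure lborel {t. coord_update (\<chi> j. y j) i t \<in> S}"
    proof -
      have "(\<lambda>t. coord_update (\<chi> j. y j) i t) \<in> borel_measurable borel"
        unfolding coord_update_def by (rule borel_measurable_vec_lambdaI) measurable
      then have "{t. coord_update (\<chi> j. y j) i t \<in> S} \<in> sets borel"
        using S(1) by (auto simp: vimage_def dest: measurable_sets_borel)
      then show ?thesis
        unfolding eq by (simp add: nn_integral_indicator[symmetric] indicator_def del: nn_integral_indicator)
    qed
    show "(\<integral>\<^sup>+ t. indicator S (\<chi> j. (y(i := t)) j) \<partial>lborel)
        \<le> ennreal (\<epsilon> * (u $ i - l $ i)) * indicator ?B y"
    proof (cases "y \<in> ?B")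
      case True
      then show ?thesis using slice[of "\<chi> j. y j"] unfolding inn by simp
    next
      case False
      have "coord_update (\<chi> j. y j) i t \<notin> S" for t
      proof
        assume "coord_update (\<chi> j. y j) i t \<in> S"
        then have "coord_update (\<chi> j. y j) i t \<in> cbox l u" using S by auto
        then have "y j \<in> {l $ j .. u $ j}" if "j \<noteq> i" for j
          using that by (auto simp: coord_update_def mem_box_cart dest: spec[of _ j])
        then show False using False y by (auto simp: space_PiM PiE_def)
      qed
      then show ?thesis unfolding inn by simp
    qed
  qed
  also have "\<dots> = ennreal (\<epsilon> * (u $ i - l $ i)) * (\<Prod>j\<in>?J. ennreal (u $ j - l $ j))"
    using Bs le by (simp add: nn_integral_cmult_indicator emeasure_PiM)
  also have "\<dots> = ennreal (\<epsilon> * (u $ i - l $ i) * (\<Prod>j\<in>?J. u $ j - l $ j))"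
    using le \<open>0 \<le> \<epsilon>\<close> by (simp add: prod_ennreal ennreal_mult prod_nonneg)
  also have "\<epsilon> * (u $ i - l $ i) * (\<Prod>j\<in>?J. u $ j - l $ j) = \<epsilon> * measure lborel (cbox l u)"
    by (subst content_cbox_prod[OF le]) (simp add: prod.remove[of UNIV i])
  finally show ?thesis .
qed

section \<open>A Remez inequality for multiaffine functions\<close>

text \<open>The intermediate points on the way from \<open>v\<close> to \<open>x\<close> when coordinates are exchanged one at a time.\<close>
definition coord_mix :: "'n set \<Rightarrow> real^'n \<Rightarrow> real^'n \<Rightarrow> real^'n" where
  "coord_mix I v x = (\<chi> j. if j \<in> I then x $ j else v $ j)"

text \<open>Affine interpolation between the coordinate values 0 and 1 avoids quantifying over the
  coefficients, so that membership is checked by polynomial arithmetic.\<close>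
definition multiaffine :: "(real^'n \<Rightarrow> real) \<Rightarrow> bool" where
  "multiaffine f \<longleftrightarrow> (\<forall>i x t. f (coord_update x i t) = (1 - t) * f (coord_update x i 0) + t * f (coord_update x i 1))"

text \<open>If an affine function drops from the value \<open>m\<close> at \<open>s\<close> to less than \<open>m / 2\<close> somewhere in the interval, its slope
  is at least \<open>m / (2 (q - p))\<close> in absolute value; values below \<open>\<delta> m\<close> then only occur within distance
  \<open>2 \<delta> (q - p)\<close> of its zero.\<close>
lemma affine_small_values_1D:
  fixes A B s :: real
  assumes s: "s \<in> {p..q}" and \<delta>: "0 < \<delta>" "\<delta> \<le> 1/2"
  shows "emeasure lborel {t \<in> {p..q}. \<bar>A + B * t\<bar> < \<delta> * \<bar>A + B * s\<bar>} \<le> ennreal (4 * \<delta> * (q - p))"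
proof (cases "{t \<in> {p..q}. \<bar>A + B * t\<bar> < \<delta> * \<bar>A + B * s\<bar>} = {}")
  case False
  define m where "m = \<bar>A + B * s\<bar>"
  from False obtain t where t: "t \<in> {p..q}" "\<bar>A + B * t\<bar> < \<delta> * m" by (auto simp: m_def)
  have m0: "0 < m" using t \<delta> by (smt (verit) mult_nonneg_nonpos)
  have "\<delta> * m \<le> m / 2" using \<delta> m0 by (simp add: mult_right_mono)
  moreover have "m \<le> \<bar>A + B * t\<bar> + \<bar>B\<bar> * \<bar>s - t\<bar>"
    unfolding m_def by (simp add: abs_mult[symmetric] algebra_simps)
  moreover have "\<bar>B\<bar> * \<bar>s - t\<bar> \<le> \<bar>B\<bar> * (q - p)"
    using s t by (intro mult_left_mono) auto
  ultimately have mB: "m \<le> 2 * (\<bar>B\<bar> * (q - p))" using t by linarith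
  then have B: "B \<noteq> 0" using m0 by auto
  define r where "r = \<delta> * m / \<bar>B\<bar>"
  have "\<delta> * m \<le> \<delta> * (2 * (\<bar>B\<bar> * (q - p)))" using mB \<delta> by (intro mult_left_mono) auto
  then have r: "0 \<le> r" "2 * r \<le> 4 * \<delta> * (q - p)"
    using B \<delta> m0 by (auto simp: r_def field_simps)
  have "{t \<in> {p..q}. \<bar>A + B * t\<bar> < \<delta> * m} \<subseteq> {- A / B - r .. - A / B + r}"
  proof
    fix t assume "t \<in> {t \<in> {p..q}. \<bar>A + B * t\<bar> < \<delta> * m}"
    moreover have "A + B * t = B * (t - (- A / B))" using B by (simp add: field_simps)
    ultimately have "\<bar>B\<bar> * \<bar>t - (- A / B)\<bar> < \<delta> * m" by (simp add: abs_mult)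
    then have "\<bar>t - (- A / B)\<bar> < r" using B by (simp add: r_def field_simps)
    then show "t \<in> {- A / B - r .. - A / B + r}" by auto
  qed
  then have "emeasure lborel {t \<in> {p..q}. \<bar>A + B * t\<bar> < \<delta> * m} \<le> emeasure lborel {- A / B - r .. - A / B + r}"
    by (rule emeasure_mono) simp
  also have "\<dots> = ennreal (2 * r)" using r by simp
  also have "\<dots> \<le> ennreal (4 * \<delta> * (q - p))" using r by (intro ennreal_leI)
  finally show ?thesis by (simp add: m_def)
next
  case True
  then show ?thesis by (simp only: emeasure_empty zero_le)
qed

text \<open>Induction over the set \<open>I\<close> of coordinates already moved from \<open>v\<close> to \<open>x\<close>. Moving one further coordinate
  \<open>i\<close>, the function is affine in \<open>x $ i\<close> and takes the previous value at \<open>x $ i = v $ i\<close>; so on each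
  slice in direction \<open>i\<close> it shrinks by more than the factor \<open>\<delta>\<close> only on a fraction \<open>4 \<delta>\<close> of the slice.\<close>
lemma multiaffine_small_values:
  fixes f :: "real^'n \<Rightarrow> real"
  assumes f: "multiaffine f" "f \<in> borel_measurable borel" and v: "v \<in> cbox l u"
    and \<delta>: "0 < \<delta>" "\<delta> \<le> 1/2"
  shows "\<exists>S\<in>sets borel. emeasure lborel S \<le> ennreal (real (card I) * (4 * \<delta>) * measure lborel (cbox l u)) \<and>
     (\<forall>x \<in> cbox l u - S. \<delta> ^ card I * \<bar>f v\<bar> \<le> \<bar>f (coord_mix I v x)\<bar>)"
proof (induction I rule: finite_induct[OF finite])
  case 1
  show ?case by (rule bexI[of _ "{}"]) (auto simp: coord_mix_def)
next
  case (2 i I)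
  then obtain S where S: "S \<in> sets borel"
      "emeasure lborel S \<le> ennreal (real (card I) * (4 * \<delta>) * measure lborel (cbox l u))"
      "\<And>x. x \<in> cbox l u - S \<Longrightarrow> \<delta> ^ card I * \<bar>f v\<bar> \<le> \<bar>f (coord_mix I v x)\<bar>" by auto
  define R where "R = {x \<in> cbox l u. \<bar>f (coord_mix (insert i I) v x)\<bar> < \<delta> * \<bar>f (coord_mix I v x)\<bar>}"
  have vi: "v $ i \<in> {l $ i .. u $ i}" and le: "l $ k \<le> u $ k" for k
    using v by (auto simp: mem_box_cart intro: order_trans)
  have mm: "coord_mix J v \<in> borel_measurable borel" for J
    unfolding coord_mix_def by (rule borel_measurable_vec_lambdaI) (auto intro: borel_measurable_continuous_onI continuous_intros)
  have [measurable]: "(\<lambda>x. f (coord_mix J v x)) \<in> borel_measurable borel" for J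
    using measurable_compose[OF mm f(2)] by simp
  have R: "R \<in> sets borel" unfolding R_def by measurable
  have "emeasure lborel R \<le> ennreal (4 * \<delta> * measure lborel (cbox l u))"
  proof (rule emeasure_le_by_slices[OF R _ le])
    show "R \<subseteq> cbox l u" "0 \<le> 4 * \<delta>" using \<delta> by (auto simp: R_def)
    fix x
    define w where "w = coord_mix I v x"
    define A B where "A = f (coord_update w i 0)" and "B = f (coord_update w i 1) - f (coord_update w i 0)"
    have aff: "f (coord_update w i t) = A + B * t" for t
      using f(1)[unfolded multiaffine_def, rule_format, of w i t] by (simp add: A_def B_def algebra_simps)
    have base: "coord_mix I v (coord_update x i t) = coord_update w i (v $ i)" for t
      using 2 by (auto simp: w_def coord_mix_def coord_update_def vec_eq_iff)
    have step: "coord_mix (insert i I) v (coord_update x i t) = coord_update w i t" for t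
      by (auto simp: w_def coord_mix_def coord_update_def vec_eq_iff)
    have "{t. coord_update x i t \<in> R} \<subseteq> {t \<in> {l $ i .. u $ i}. \<bar>A + B * t\<bar> < \<delta> * \<bar>A + B * (v $ i)\<bar>}"
      by (auto simp: R_def base step aff) (auto simp: mem_box_cart coord_update_def split: if_splits)
    then have "emeasure lborel {t. coord_update x i t \<in> R} \<le> emeasure lborel {t \<in> {l $ i .. u $ i}. \<bar>A + B * t\<bar> < \<delta> * \<bar>A + B * (v $ i)\<bar>}"
      by (rule emeasure_mono) measurable
    also have "\<dots> \<le> ennreal (4 * \<delta> * (u $ i - l $ i))"
      by (rule affine_small_values_1D[OF vi \<delta>])
    finally show "emeasure lborel {t. coord_update x i t \<in> R} \<le> ennreal (4 * \<delta> * (u $ i - l $ i))" .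
  qed
  then have "emeasure lborel (S \<union> R) \<le> ennreal (real (card I) * (4 * \<delta>) * measure lborel (cbox l u)) + ennreal (4 * \<delta> * measure lborel (cbox l u))"
    using S R by (intro order_trans[OF emeasure_subadditive] add_mono) auto
  also have "\<dots> = ennreal (real (card (insert i I)) * (4 * \<delta>) * measure lborel (cbox l u))"
    using 2 \<delta> by (subst ennreal_plus[symmetric]) (auto simp: algebra_simps)
  finally have "emeasure lborel (S \<union> R) \<le> ennreal (real (card (insert i I)) * (4 * \<delta>) * measure lborel (cbox l u))" .
  moreover have "\<delta> ^ card (insert i I) * \<bar>f v\<bar> \<le> \<bar>f (coord_mix (insert i I) v x)\<bar>" if x: "x \<in> cbox l u - (S \<union> R)" for x
  proof -
    have "\<delta> * (\<delta> ^ card I * \<bar>f v\<bar>) \<le> \<delta> * \<bar>f (coord_mix I v x)\<bar>"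
      using S(3)[of x] x \<delta> by (intro mult_left_mono) auto
    also have "\<dots> \<le> \<bar>f (coord_mix (insert i I) v x)\<bar>" using x by (auto simp: R_def)
    finally show ?thesis using 2 by (simp add: mult.assoc)
  qed
  ultimately show ?case using S R by (intro bexI[of _ "S \<union> R"]) auto
qed

text \<open>Equals \<open>4 / \<delta> ^ (2 * n)\<close> for \<open>\<delta> = 1 / (16 * n)\<close>, the factor for which the \<open>n\<close> exceptional sets together
  fill a quarter of the box.\<close>
definition remez_const :: "nat \<Rightarrow> real" where
  "remez_const n = 4 * (16 * real n) ^ (2 * n)"

text \<open>The exceptional set fills at most a quarter of the box, so at least a quarter of the box remains inside \<open>E\<close>, and
  there \<open>f\<close> is at least \<open>\<delta> ^ n\<close> times its value at \<open>v\<close>.\<close>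
lemma multiaffine_remez_L2:
  fixes f :: "real^'n \<Rightarrow> real"
  assumes f: "multiaffine f" "continuous_on UNIV f" and v: "v \<in> cbox l u"
    and E: "E \<in> sets borel" "E \<subseteq> cbox l u" "measure lborel (cbox l u) \<le> 2 * measure lborel E"
  shows "(f v)\<^sup>2 * measure lborel (cbox l u) \<le> remez_const CARD('n) * (LINT x:E|lborel. (f x)\<^sup>2)"
proof -
  define n where "n = CARD('n)"
  define V where "V = measure lborel (cbox l u)"
  define \<delta> where "\<delta> = 1 / (16 * real n)"
  have "n > 0" by (simp add: n_def)
  then have n: "n > 0" "real n \<ge> 1" by linarith+
  have \<delta>: "0 < \<delta>" "\<delta> \<le> 1/2" "real n * (4 * \<delta>) = 1/4"
    using n by (simp_all add: \<delta>_def field_simps)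
  have fm: "f \<in> borel_measurable borel" using f(2) by (rule borel_measurable_continuous_onI)
  have mixU: "coord_mix UNIV v x = x" for x by (simp add: coord_mix_def vec_eq_iff)
  obtain S where S: "S \<in> sets borel" "emeasure lborel S \<le> ennreal (V / 4)"
      "\<And>x. x \<in> cbox l u - S \<Longrightarrow> \<delta> ^ n * \<bar>f v\<bar> \<le> \<bar>f x\<bar>"
    using multiaffine_small_values[OF f(1) fm v \<delta>(1,2), of UNIV]
    by (auto simp: n_def[symmetric] \<delta> mixU V_def)
  have "cbox l u \<in> fmeasurable lborel"
    by (rule fmeasurable_cbox)
  then have Efin: "E \<in> fmeasurable lborel"
    by (rule fmeasurableI2) (use E in simp_all)
  have Sfin: "S \<in> fmeasurable lborel"
    using S(1) le_less_trans[OF S(2) ennreal_less_top] by (intro fmeasurableI) simp_all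
  have mS: "measure lborel S \<le> V / 4"
    using S(2) Sfin by (simp add: emeasure_eq_measure2 V_def)
  have "measure lborel E \<le> measure lborel ((E - S) \<union> S)"
    using Efin Sfin by (intro measure_mono_fmeasurable) auto
  also have "\<dots> \<le> measure lborel (E - S) + measure lborel S"
    using E S(1) by (intro measure_Un_le) simp_all
  finally have mES: "V / 4 \<le> measure lborel (E - S)" using mS E(3) by (simp add: V_def)
  have ESfin: "E - S \<in> fmeasurable lborel" using Efin Sfin by auto
  have cf: "set_integrable lborel (cbox l u) (\<lambda>x. (f x)\<^sup>2)"
    unfolding set_integrable_def
    by (rule borel_integrable_compact) (auto intro!: continuous_intros continuous_on_subset[OF f(2)])
  have iE: "set_integrable lborel E (\<lambda>x. (f x)\<^sup>2)"
    by (rule set_integrable_subset[OF cf]) (use E in auto)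
  have "(\<delta> ^ n * \<bar>f v\<bar>)\<^sup>2 * (V / 4) \<le> (\<delta> ^ n * \<bar>f v\<bar>)\<^sup>2 * measure lborel (E - S)"
    using mES by (intro mult_left_mono) auto
  also have "\<dots> = (\<integral>x. (\<delta> ^ n * \<bar>f v\<bar>)\<^sup>2 * indicator (E - S) x \<partial>lborel)"
    by simp
  also have "\<dots> \<le> (LINT x:E|lborel. (f x)\<^sup>2)"
    unfolding set_lebesgue_integral_def
  proof (rule integral_mono)
    show "integrable lborel (\<lambda>x. (\<delta> ^ n * \<bar>f v\<bar>)\<^sup>2 * indicator (E - S) x)"
      using ESfin by (intro integrable_mult_right) (auto simp: fmeasurable_def)
    show "integrable lborel (\<lambda>x. indicat_real E x *\<^sub>R (f x)\<^sup>2)" using iE by (simp add: set_integrable_def)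
    fix x
    show "(\<delta> ^ n * \<bar>f v\<bar>)\<^sup>2 * indicator (E - S) x \<le> indicat_real E x *\<^sub>R (f x)\<^sup>2"
    proof (cases "x \<in> E - S")
      case True
      then have "(\<delta> ^ n * \<bar>f v\<bar>)\<^sup>2 \<le> \<bar>f x\<bar>\<^sup>2"
        using S(3)[of x] E \<delta> by (intro power_mono) auto
      then show ?thesis using True by auto
    qed (auto simp: indicator_def)
  qed
  finally have *: "(\<delta> ^ n * \<bar>f v\<bar>)\<^sup>2 * (V / 4) \<le> (LINT x:E|lborel. (f x)\<^sup>2)" .
  have "(f v)\<^sup>2 * V = remez_const n * ((\<delta> ^ n * \<bar>f v\<bar>)\<^sup>2 * (V / 4))"
  proof -
    have "(16 * real n) ^ (2 * n) * (\<delta> ^ n)\<^sup>2 = (16 * real n * \<delta>) ^ (2 * n)"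
      by (simp only: power_mult_distrib power_even_eq)
    also have "16 * real n * \<delta> = 1" using n by (simp add: \<delta>_def)
    finally have "(16 * real n) ^ (2 * n) * (\<delta> ^ n)\<^sup>2 = 1" by simp
    then have "(f v)\<^sup>2 * V = (16 * real n) ^ (2 * n) * (\<delta> ^ n)\<^sup>2 * ((f v)\<^sup>2 * V)" by simp
    also have "\<dots> = remez_const n * ((\<delta> ^ n * \<bar>f v\<bar>)\<^sup>2 * (V / 4))"
      by (simp only: remez_const_def power_mult_distrib power2_abs)
    finally show ?thesis .
  qed
  also have "\<dots> \<le> remez_const n * (LINT x:E|lborel. (f x)\<^sup>2)"
    using * by (intro mult_left_mono) (auto simp: remez_const_def)
  finally show ?thesis by (simp add: V_def n_def)
qed

lemma norm_vec_power2: "(norm (x :: real^'m))\<^sup>2 = (\<Sum>k\<in>UNIV. (x $ k)\<^sup>2)"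
  unfolding power2_norm_eq_inner by (simp add: inner_vec_def power2_eq_square)

lemma set_integrable_norm_power2:
  fixes q :: "real^'n \<Rightarrow> 'm::euclidean_space"
  assumes q: "continuous_on UNIV q" and E: "E \<in> sets borel" "E \<subseteq> cbox l u"
  shows "set_integrable lborel E (\<lambda>x. (norm (q x))\<^sup>2)"
proof (rule set_integrable_subset)
  show "set_integrable lborel (cbox l u) (\<lambda>x. (norm (q x))\<^sup>2)"
    unfolding set_integrable_def
    by (rule borel_integrable_compact) (auto intro!: continuous_intros continuous_on_subset[OF q])
qed (use E in simp_all)

lemma multiaffine_field_remez_L2:
  fixes q :: "real^'n \<Rightarrow> real^'m"
  assumes q: "\<And>k. multiaffine (\<lambda>x. q x $ k)" "continuous_on UNIV q" and v: "v \<in> cbox l u"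
    and E: "E \<in> sets borel" "E \<subseteq> cbox l u" "measure lborel (cbox l u) \<le> 2 * measure lborel E"
  shows "(norm (q v))\<^sup>2 * measure lborel (cbox l u) \<le> remez_const CARD('n) * (LINT x:E|lborel. (norm (q x))\<^sup>2)"
proof -
  have ck: "continuous_on UNIV (\<lambda>x. q x $ k)" for k
    using q(2) by (rule continuous_on_component)
  have int: "integrable lborel (\<lambda>x. indicat_real E x *\<^sub>R (q x $ k)\<^sup>2)" for k
    using set_integrable_norm_power2[OF ck E(1,2)] by (simp add: set_integrable_def)
  have "(norm (q v))\<^sup>2 * measure lborel (cbox l u) = (\<Sum>k\<in>UNIV. (q v $ k)\<^sup>2 * measure lborel (cbox l u))"
    by (simp add: norm_vec_power2 sum_distrib_right)
  also have "\<dots> \<le> (\<Sum>k\<in>UNIV. remez_const CARD('n) * (LINT x:E|lborel. (q x $ k)\<^sup>2))"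
    by (intro sum_mono multiaffine_remez_L2[OF q(1) ck v E])
  also have "\<dots> = remez_const CARD('n) * (\<Sum>k\<in>UNIV. LINT x:E|lborel. (q x $ k)\<^sup>2)"
    by (simp add: sum_distrib_left)
  also have "(\<Sum>k\<in>UNIV. LINT x:E|lborel. (q x $ k)\<^sup>2) = (LINT x:E|lborel. (norm (q x))\<^sup>2)"
    unfolding set_lebesgue_integral_def norm_vec_power2 scaleR_sum_right
    by (rule Bochner_Integration.integral_sum[symmetric]) (rule int)
  finally show ?thesis .
qed

section \<open>Closed surfaces of class C2 are null sets\<close>

text \<open>Near \<open>X\<close> the gradient of the defining function is close to \<open>v = G X\<close>. Seen from a point \<open>a\<close> slightly behind \<open>X\<close>
  in direction \<open>- v\<close>, every ray meeting a much smaller ball around \<open>X\<close> points roughly along \<open>v\<close>, so \<open>g\<close> is strictly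
  increasing along it and the ray hits \<open>\<Gamma>\<close> at most once. Such starlike sets are negligible.\<close>
lemma C2_defining_negligible_near:
  assumes C: "C2_defining \<Gamma> U g G" and X: "X \<in> \<Gamma>" "X \<in> U" and cl: "closed \<Gamma>"
  shows "\<exists>\<epsilon>>0. negligible (\<Gamma> \<inter> cball X \<epsilon>)"
proof -
  define v where "v = G X"
  from C have U: "open U" "\<Gamma> \<inter> U = {x \<in> U. g x = 0}"
    and gd: "\<And>x. x \<in> U \<Longrightarrow> (g has_derivative (\<lambda>h. h \<bullet> G x)) (at x)"
    and nz: "v \<noteq> 0"
    using X by (auto simp: C2_defining_def gderiv_def v_def)
  from C obtain H :: "real^3 \<Rightarrow> real^3^3"
    where "\<And>x. x \<in> U \<Longrightarrow> (G has_derivative (\<lambda>v. H x *v v)) (at x)"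
    by (auto simp: C2_defining_def)
  then have "isCont G X" using X has_derivative_continuous by blast
  then obtain \<delta>1 where d1: "\<delta>1 > 0" "\<And>y. dist y X < \<delta>1 \<Longrightarrow> dist (G y) (G X) < norm v / 2"
    using nz unfolding continuous_at_eps_delta by (metis half_gt_zero zero_less_norm_iff)
  obtain \<delta>2 where d2: "\<delta>2 > 0" "ball X \<delta>2 \<subseteq> U" using U X open_contains_ball by blast
  define \<delta> where "\<delta> = min \<delta>1 \<delta>2"
  have \<delta>: "\<delta> > 0" "\<And>y. y \<in> ball X \<delta> \<Longrightarrow> y \<in> U \<and> norm (G y - v) < norm v / 2"
    using d1 d2 by (auto simp: \<delta>_def dist_norm v_def norm_minus_commute)
  \<comment> \<open>The centre \<open>a\<close> has distance \<open>\<delta> / 2\<close> from \<open>X\<close>. Radius \<open>\<delta> / 8\<close> is small enough: in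
    \<open>d \<bullet> G y\<close> the contribution of the deviation from direction \<open>v\<close> is at most \<open>3/16 * \<delta> * norm v\<close>, that of
    \<open>v\<close> itself at least \<open>1/4 * \<delta> * norm v\<close>.\<close>
  define s where "s = \<delta> / (2 * norm v)"
  define \<epsilon> where "\<epsilon> = \<delta> / 8"
  define a where "a = X - s *\<^sub>R v"
  have s: "s > 0" using \<delta> nz by (simp add: s_def)
  have ball: "cball X \<epsilon> \<subseteq> ball X \<delta>" using \<delta> by (auto simp: \<epsilon>_def)
  have pos: "0 < d \<bullet> G y" if d: "a + d \<in> cball X \<epsilon>" and y: "y \<in> ball X \<delta>" for d y
  proof -
    define e where "e = a + d - X"
    have e: "norm e \<le> \<epsilon>" "d = e + s *\<^sub>R v"
      using d by (auto simp: e_def a_def dist_norm norm_minus_commute)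
    define k where "k = G y - v"
    have k: "norm k < norm v / 2" "G y = v + k" using \<delta>(2)[OF y] by (auto simp: k_def)
    have "norm (G y) \<le> 3 / 2 * norm v" using norm_triangle_ineq[of v k] k by simp
    then have "\<bar>e \<bullet> G y\<bar> \<le> \<epsilon> * (3 / 2 * norm v)"
      using e Cauchy_Schwarz_ineq2[of e "G y"] by (meson mult_mono norm_ge_zero order_trans)
    moreover have "v \<bullet> G y \<ge> (norm v)\<^sup>2 / 2"
    proof -
      have "\<bar>v \<bullet> k\<bar> \<le> norm v * (norm v / 2)"
        using k Cauchy_Schwarz_ineq2[of v k] by (meson less_imp_le mult_left_mono norm_ge_zero order_trans)
      then show ?thesis by (simp add: k inner_add_right power2_norm_eq_inner[symmetric]) (simp add: power2_eq_square)
    qed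
    then have "s * (v \<bullet> G y) \<ge> s * ((norm v)\<^sup>2 / 2)" using s by (intro mult_left_mono) auto
    moreover have "s * ((norm v)\<^sup>2 / 2) = \<delta> * norm v / 4"
      using nz by (simp add: s_def power2_eq_square)
    moreover have "\<epsilon> * (3 / 2 * norm v) < \<delta> * norm v / 4"
      using nz \<delta> by (simp add: \<epsilon>_def)
    moreover have "d \<bullet> G y = e \<bullet> G y + s * (v \<bullet> G y)" by (simp add: e inner_add_left)
    ultimately show ?thesis by linarith
  qed
  have incr: "g (a + p *\<^sub>R d) < g (a + q *\<^sub>R d)"
    if pq: "p < q" and d: "a + p *\<^sub>R d \<in> cball X \<epsilon>" "a + q *\<^sub>R d \<in> cball X \<epsilon>" "a + d \<in> cball X \<epsilon>" for p q d
  proof (rule DERIV_pos_imp_increasing[OF pq, of "\<lambda>t. g (a + t *\<^sub>R d)"])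
    fix t assume t: "p \<le> t" "t \<le> q"
    have "a + t *\<^sub>R d \<in> closed_segment (a + p *\<^sub>R d) (a + q *\<^sub>R d)"
      unfolding in_segment
    proof (intro exI conjI)
      let ?w = "(t - p) / (q - p)"
      show "0 \<le> ?w" "?w \<le> 1" using t pq by auto
      have "(1 - w) * p + w * q = p + w * (q - p)" for w :: real by (simp add: algebra_simps)
      then have "(1 - ?w) * p + ?w * q = p + ?w * (q - p)" .
      also have "\<dots> = t" using pq by simp
      finally have w: "(1 - ?w) * p + ?w * q = t" .
      have "(1 - ?w) *\<^sub>R (a + p *\<^sub>R d) + ?w *\<^sub>R (a + q *\<^sub>R d) = a + ((1 - ?w) * p + ?w * q) *\<^sub>R d"
        by (simp add: scaleR_add_right scaleR_left_diff_distrib scaleR_add_left)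
      then show "a + t *\<^sub>R d = (1 - ?w) *\<^sub>R (a + p *\<^sub>R d) + ?w *\<^sub>R (a + q *\<^sub>R d)"
        using w by simp
    qed
    then have y: "a + t *\<^sub>R d \<in> ball X \<delta>"
      using closed_segment_subset[OF d(1,2) convex_cball] ball by blast
    let ?y = "a + t *\<^sub>R d"
    have "((\<lambda>t. g (a + t *\<^sub>R d)) has_derivative (\<lambda>h. (h *\<^sub>R d) \<bullet> G ?y)) (at t)"
      by (rule has_derivative_compose[of "\<lambda>t. a + t *\<^sub>R d" "\<lambda>h. h *\<^sub>R d" t UNIV g])
         (use gd \<delta>(2)[OF y] in \<open>auto intro!: derivative_eq_intros\<close>)
    then have "((\<lambda>t. g (a + t *\<^sub>R d)) has_real_derivative (d \<bullet> G ?y)) (at t)"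
      by (simp add: has_field_derivative_def mult_commute_abs)
    then show "\<exists>z. ((\<lambda>t. g (a + t *\<^sub>R d)) has_real_derivative z) (at t) \<and> 0 < z"
      using pos[OF d(3) y] by blast
  qed
  have "negligible (\<Gamma> \<inter> cball X \<epsilon>)"
  proof (rule starlike_negligible[where a = a])
    show "closed (\<Gamma> \<inter> cball X \<epsilon>)" using cl by auto
    fix c x assume c: "a + c *\<^sub>R x \<in> \<Gamma> \<inter> cball X \<epsilon>" "a + x \<in> \<Gamma> \<inter> cball X \<epsilon>" "0 \<le> c"
    have z: "g (a + c *\<^sub>R x) = 0" "g (a + 1 *\<^sub>R x) = 0"
    proof -
      have "\<Gamma> \<inter> cball X \<epsilon> \<subseteq> {x \<in> U. g x = 0}" using ball \<delta>(2) U(2) by blast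
      then show "g (a + c *\<^sub>R x) = 0" "g (a + 1 *\<^sub>R x) = 0"
        using c by auto
    qed
    show "c = 1"
      using incr[of c 1 x] incr[of 1 c x] c z by (cases c "1::real" rule: linorder_cases) auto
  qed
  moreover have "\<epsilon> > 0" using \<delta> by (simp add: \<epsilon>_def)
  ultimately show ?thesis by blast
qed

lemma negligible_closed_C2_surface:
  assumes "closed_C2_surface \<Gamma>"
  shows "negligible \<Gamma>"
proof (subst locally_negligible_alt, rule ballI)
  fix X assume X: "X \<in> \<Gamma>"
  have cl: "closed \<Gamma>" using assms by (auto simp: closed_C2_surface_def compact_imp_closed)
  obtain U g G where "C2_defining \<Gamma> U g G" "X \<in> U" using assms X unfolding closed_C2_surface_def by blast
  then obtain \<epsilon> where e: "\<epsilon> > 0" "negligible (\<Gamma> \<inter> cball X \<epsilon>)"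
    using C2_defining_negligible_near X cl by blast
  have "negligible (\<Gamma> \<inter> ball X \<epsilon>)" by (rule negligible_subset[OF e(2)]) auto
  then show "\<exists>U. openin (top_of_set \<Gamma>) U \<and> X \<in> U \<and> negligible U"
    using X e by (intro exI[of _ "\<Gamma> \<inter> ball X \<epsilon>"]) (auto simp: openin_open_Int)
qed

section \<open>The two sides of the interface within an element\<close>

text \<open>A small ball around a point off \<open>\<Gamma>\<close> meets the box in a convex set that avoids \<open>\<Gamma>\<close>, hence lies
  entirely in \<open>A\<close> or in \<open>B\<close>. This also covers points on the boundary of the box, which only belong to the
  closure of a subdomain.\<close>
lemma openin_closed_side:
  assumes A: "open A" "open B" "A \<inter> B = {}" "A \<union> B = box a b - \<Gamma>" and \<Gamma>: "closed \<Gamma>"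
    and ne: "box a b \<noteq> {}" and T: "T \<subseteq> cbox a b"
  shows "openin (top_of_set T) (T \<inter> side \<Gamma> A)"
  unfolding openin_euclidean_subtopology_iff
proof (intro conjI ballI)
  fix x assume x: "x \<in> T \<inter> side \<Gamma> A"
  then obtain r where r: "r > 0" "ball x r \<subseteq> - \<Gamma>"
    using \<Gamma> open_contains_ball[of "- \<Gamma>"] by (auto simp: side_def open_Compl)
  define C where "C = ball x r \<inter> box a b"
  have "connected C" unfolding C_def
    by (intro convex_connected convex_Int convex_ball convex_box)
  moreover have "C \<subseteq> A \<union> B" using r A by (auto simp: C_def)
  moreover have "x \<in> ball x r" "x \<in> closure A" using x r by (auto simp: side_def)
  then have "ball x r \<inter> A \<noteq> {}" using open_Int_closure_eq_empty[of "ball x r" A] by blast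
  then have "A \<inter> C \<noteq> {}" using A unfolding C_def by blast
  ultimately have "B \<inter> C = {}" using connectedD[of C A B] A by auto
  then have CA: "C \<subseteq> A" using \<open>C \<subseteq> A \<union> B\<close> by auto
  have "ball x r \<inter> cbox a b \<subseteq> closure C"
    unfolding C_def using open_Int_closure_subset[of "ball x r" "box a b"] ne by simp
  then have "ball x r \<inter> cbox a b \<subseteq> side \<Gamma> A"
    using closure_mono[OF CA] r by (auto simp: side_def)
  then show "\<exists>e>0. \<forall>x'\<in>T. dist x' x < e \<longrightarrow> x' \<in> T \<inter> side \<Gamma> A"
    using r T by (intro exI[of _ r]) (auto simp: dist_commute)
qed auto

lemma cartesian_mesh_element:
  assumes mesh: "cartesian_mesh a b \<T>" and T: "(l, u) \<in> \<T>"
  shows "l $ i < u $ i" "u $ i - l $ i \<le> mesh_size \<T>" "cbox l u \<subseteq> cbox a b"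
proof -
  obtain N x where x: "\<And>i. x i 0 = a $ i" "\<And>i. x i (N i) = b $ i"
      "\<And>i k. k < N i \<Longrightarrow> x i k < x i (Suc k)"
    and \<T>: "\<T> = {(\<chi> i. x i (k i), \<chi> i. x i (Suc (k i))) | k. \<forall>i. k i < N i}"
    using mesh unfolding cartesian_mesh_def by blast
  obtain k where k: "\<And>i. k i < N i" "l = (\<chi> i. x i (k i))" "u = (\<chi> i. x i (Suc (k i)))"
    using T \<T> by auto
  show "l $ i < u $ i" using k x by simp
  have mono: "x i m \<le> x i n" if "m \<le> n" "n \<le> N i" for i m n
    using that
  proof (induction n rule: dec_induct)
    case (step n)
    then show ?case using x(3)[of n i] by simp
  qed simp
  have "a $ j \<le> l $ j \<and> u $ j \<le> b $ j" for j
    using mono[of 0 "k j" j] mono[of "Suc (k j)" "N j" j] k(1)[of j] x by (simp add: k)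
  then show "cbox l u \<subseteq> cbox a b"
    by (auto simp: subset_iff mem_box_cart) (meson order_trans)+
  have "{k. \<forall>i. k i < N i} = Pi\<^sub>E UNIV (\<lambda>i. {..<N i})" by (auto simp: PiE_def Pi_def)
  then have fin: "finite {k. \<forall>i. k i < N i}" by (simp add: finite_PiE)
  have "finite \<T>" unfolding \<T> by (rule finite_image_set[OF fin])
  then have fin: "finite (\<Union>T\<in>\<T>. \<Union>i. {snd T $ i - fst T $ i})" by simp
  have "{u $ i - l $ i | l u i. (l, u) \<in> \<T>} \<subseteq> (\<Union>T\<in>\<T>. \<Union>i. {snd T $ i - fst T $ i})"
  proof clarify
    fix l u :: "real^3" and i assume "(l, u) \<in> \<T>"
    then show "u $ i - l $ i \<in> (\<Union>T\<in>\<T>. \<Union>i. {snd T $ i - fst T $ i})"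
      by (intro UN_I[of "(l, u)"] UN_I[of i]) simp_all
  qed
  then have "finite {u $ i - l $ i | l u i. (l, u) \<in> \<T>}" using fin by (rule finite_subset)
  then show "u $ i - l $ i \<le> mesh_size \<T>"
    unfolding mesh_size_def using T by (intro Max_ge) auto
qed

lemma element_edges_subset:
  assumes le: "\<And>k. l $ k \<le> u $ k" and e: "e \<in> element_edges (l, u)"
  shows "e \<subseteq> cbox l u"
proof -
  obtain v w where e: "e = closed_segment v w" "v \<in> element_vertices (l, u)" "w \<in> element_vertices (l, u)"
    using e unfolding element_edges_def by blast
  have "x \<in> cbox l u" if "x \<in> element_vertices (l, u)" for x
    unfolding mem_box_cart
  proof
    fix i
    have "x $ i = l $ i \<or> x $ i = u $ i" using that by (simp add: element_vertices_def)
    then show "l $ i \<le> x $ i \<and> x $ i \<le> u $ i" using le[of i] by auto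
  qed
  then have "v \<in> cbox l u" "w \<in> cbox l u" using e by blast+
  then show ?thesis unfolding e by (rule closed_segment_subset) (rule convex_box)
qed

lemma centroid_in_element:
  assumes "admissible_triangle \<Gamma> (l, u) P Q R" and le: "\<And>k. l $ k \<le> u $ k"
  shows "centroid P Q R \<in> cbox l u"
proof -
  have PQR: "P \<in> cbox l u" "Q \<in> cbox l u" "R \<in> cbox l u"
    using assms(1) element_edges_subset[OF le] unfolding admissible_triangle_def by blast+
  have "l $ i \<le> centroid P Q R $ i \<and> centroid P Q R $ i \<le> u $ i" for i
  proof -
    have "l $ i \<le> P $ i" "P $ i \<le> u $ i" "l $ i \<le> Q $ i" "Q $ i \<le> u $ i" "l $ i \<le> R $ i" "R $ i \<le> u $ i"
      using PQR by (simp_all add: mem_box_cart)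
    moreover have "3 * centroid P Q R $ i = P $ i + Q $ i + R $ i" by (simp add: centroid_def)
    ultimately show ?thesis by (intro conjI) linarith+
  qed
  then show ?thesis by (simp add: mem_box_cart)
qed

text \<open>The two subelements and \<open>\<Gamma>\<close> cover the element, and \<open>\<Gamma>\<close> is a null set.\<close>
lemma measure_subelements_cover:
  assumes sep: "separates \<Gamma> (box a b) \<Omega>m \<Omega>p" and \<Gamma>: "closed_C2_surface \<Gamma>"
    and ne: "box a b \<noteq> {}" and T: "cbox l u \<subseteq> cbox a b"
    and meas: "subelement \<Gamma> \<Omega>m (l, u) \<in> sets borel" "subelement \<Gamma> \<Omega>p (l, u) \<in> sets borel"
  shows "measure lborel (cbox l u) \<le> measure lborel (subelement \<Gamma> \<Omega>m (l, u) \<union> subelement \<Gamma> \<Omega>p (l, u))"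
proof -
  let ?D = "subelement \<Gamma> \<Omega>m (l, u) \<union> subelement \<Gamma> \<Omega>p (l, u)"
  have cl: "closed \<Gamma>" using \<Gamma> by (auto simp: closed_C2_surface_def compact_imp_closed)
  have "cbox a b = closure (\<Omega>m \<union> \<Omega>p \<union> \<Gamma>)"
    using sep ne closure_box[OF ne] by (auto simp: separates_def Un_absorb2)
  also have "\<dots> = closure \<Omega>m \<union> closure \<Omega>p \<union> \<Gamma>" using cl by (simp add: closure_closed)
  finally have sub: "cbox l u \<subseteq> ?D \<union> \<Gamma>"
    using T by (auto simp: subelement_def side_def element_def)
  have "\<Gamma> \<in> null_sets lebesgue" using negligible_closed_C2_surface[OF \<Gamma>] by (simp add: negligible_iff_null_sets)
  then have null: "\<Gamma> \<in> null_sets lborel" using cl by (auto simp: null_sets_def)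
  have D: "?D \<in> fmeasurable lborel"
    by (rule fmeasurableI2[OF fmeasurable_cbox[of l u]]) (use meas in \<open>auto simp: subelement_def element_def\<close>)
  have "measure lborel (cbox l u) \<le> measure lborel (?D \<union> \<Gamma>)"
  proof (rule measure_mono_fmeasurable[OF sub])
    show "?D \<union> \<Gamma> \<in> fmeasurable lborel"
      by (rule fmeasurable.Un[OF D fmeasurableI_null_sets[OF null]])
  qed simp
  also have "\<dots> = measure lborel ?D" using D null by (intro measure_Un_null_set) auto
  finally show ?thesis .
qed

section \<open>Piecewise gradients of immersed finite element functions\<close>

lemma grad_within_UNIV_eqI:
  assumes "(p has_derivative (\<lambda>v. v \<bullet> D)) (at x)"
  shows "grad_within UNIV p x = D"
  unfolding grad_within_def
proof (rule the_equality)
  fix D' assume "(p has_derivative (\<lambda>v. v \<bullet> D')) (at x)"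
  then have "(\<lambda>v. v \<bullet> D') = (\<lambda>v. v \<bullet> D)" by (rule has_derivative_unique[OF _ assms])
  then show "D' = D" by (metis vector_eq_ldot)
qed (fact assms)

text \<open>At every point of a box with nonempty interior, boundary points included, there are admissible directions
  spanning the space, so a derivative relative to the box is unique.\<close>
lemma grad_within_relatively_open_eqI:
  fixes l u :: "real^3"
  assumes S: "openin (top_of_set (cbox l u)) S" "x \<in> S" and lu: "\<And>k. l $ k < u $ k"
    and p: "(p has_derivative (\<lambda>v. v \<bullet> D)) (at x)" and eq: "\<And>y. y \<in> S \<Longrightarrow> \<phi> y = p y"
  shows "grad_within S \<phi> x = D"
proof -
  obtain W where W: "open W" "S = cbox l u \<inter> W" using S by (auto simp: openin_open)
  have at: "at x within S = at x within cbox l u"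
    by (rule at_within_nhd[of _ W]) (use S W in auto)
  have d: "(\<phi> has_derivative (\<lambda>v. v \<bullet> D)) (at x within S)"
    by (rule has_derivative_transform[OF S(2) _ has_derivative_at_withinI[OF p]]) (rule eq)
  show ?thesis
    unfolding grad_within_def
  proof (rule the_equality[where P = "\<lambda>D. (\<phi> has_derivative (\<lambda>v. v \<bullet> D)) (at x within S)", OF d])
    fix D' assume D': "(\<phi> has_derivative (\<lambda>v. v \<bullet> D')) (at x within S)"
    have "(\<lambda>v. v \<bullet> D') = (\<lambda>v. v \<bullet> D)"
    proof (rule frechet_derivative_unique_within_closed_interval)
      show "l \<bullet> i < u \<bullet> i" if "i \<in> Basis" for i
        using lu that by (auto simp: Basis_vec_def inner_axis)
      show "x \<in> cbox l u" using S W by auto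
    qed (use d D' in \<open>simp_all add: at\<close>)
    then show "D' = D" by (metis vector_eq_ldot)
  qed
qed

lemma multiaffine_scale_shift:
  assumes "multiaffine f" shows "multiaffine (\<lambda>x. c * (f x + d))"
  unfolding multiaffine_def
proof (intro allI)
  fix i x t
  have eq: "f (coord_update x i t) = (1 - t) * f (coord_update x i 0) + t * f (coord_update x i 1)"
    using assms unfolding multiaffine_def by blast
  show "c * (f (coord_update x i t) + d) = (1 - t) * (c * (f (coord_update x i 0) + d)) + t * (c * (f (coord_update x i 1) + d))"
    unfolding eq by (simp add: algebra_simps)
qed

lemma Q1_gradient:
  assumes "p \<in> Q1"
  obtains q where "\<And>x. (p has_derivative (\<lambda>v. v \<bullet> q x)) (at x)"
    "\<And>k. multiaffine (\<lambda>x. q x $ k)" "continuous_on UNIV q"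
proof -
  obtain c0 c1 c2 c3 c12 c13 c23 c123 where p: "p = (\<lambda>x. c0 + c1 * x$1 + c2 * x$2 + c3 * x$3
      + c12 * x$1 * x$2 + c13 * x$1 * x$3 + c23 * x$2 * x$3 + c123 * x$1 * x$2 * x$3)"
    using assms unfolding Q1_def by blast
  define q :: "real^3 \<Rightarrow> real^3" where "q x = vector
    [c1 + c12 * x$2 + c13 * x$3 + c123 * x$2 * x$3,
     c2 + c12 * x$1 + c23 * x$3 + c123 * x$1 * x$3,
     c3 + c13 * x$1 + c23 * x$2 + c123 * x$1 * x$2]" for x
  have comp: "q x $ 1 = c1 + c12 * x$2 + c13 * x$3 + c123 * x$2 * x$3"
     "q x $ 2 = c2 + c12 * x$1 + c23 * x$3 + c123 * x$1 * x$3"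
     "q x $ 3 = c3 + c13 * x$1 + c23 * x$2 + c123 * x$1 * x$2" for x
    by (simp_all add: q_def)
  have comp_deriv: "((\<lambda>x :: real^3. x $ i) has_derivative (\<lambda>v. v $ i)) (at x)" for i x
    by (rule bounded_linear_imp_has_derivative) (rule bounded_linear_vec_nth)
  have "(p has_derivative (\<lambda>v. v \<bullet> q x)) (at x)" for x
  proof -
    have inner: "v \<bullet> q x = v$1 * q x$1 + v$2 * q x$2 + v$3 * q x$3" for v
      by (simp add: inner_vec_def sum_3)
    show ?thesis
      unfolding p inner comp
      by (rule has_derivative_eq_rhs, (rule derivative_intros comp_deriv)+)
         (simp add: fun_eq_iff algebra_simps)
  qed
  moreover have "multiaffine (\<lambda>x. q x $ k)" for k
  proof -
    have "multiaffine (\<lambda>x. q x $ 1)" "multiaffine (\<lambda>x. q x $ 2)" "multiaffine (\<lambda>x. q x $ 3)"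
      unfolding multiaffine_def forall_3 comp by (simp_all add: coord_update_def algebra_simps)
    then show ?thesis using exhaust_3[of k] by auto
  qed
  moreover have "continuous_on UNIV q"
  proof -
    have "continuous_on UNIV (\<lambda>x. q x $ 1)" "continuous_on UNIV (\<lambda>x. q x $ 2)" "continuous_on UNIV (\<lambda>x. q x $ 3)"
      unfolding comp by (intro continuous_intros)+
    then have "continuous_on UNIV (\<lambda>x. q x $ k)" for k using exhaust_3[of k] by auto
    then have "continuous_on UNIV (\<lambda>x. \<chi> k. q x $ k)" by (rule continuous_on_vec_lambda)
    then show ?thesis by simp
  qed
  ultimately show thesis by (rule that)
qed

lemma ife_space_piecewise_grad:
  fixes l u :: "real^3"
  assumes Tm: "openin (top_of_set (cbox l u)) Tm" and Tp: "openin (top_of_set (cbox l u)) Tp"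
    and lu: "\<And>k. l $ k < u $ k" and \<phi>: "\<phi> \<in> ife_space \<beta>m \<beta>p F nb Tm Tp"
  obtains q where "\<And>k. multiaffine (\<lambda>x. q x $ k)" "continuous_on UNIV q"
    "\<And>x. piecewise_grad Tm Tp \<phi> x = (if x \<in> Tm then q x
       else if x \<in> Tp then q x + ((\<beta>m / \<beta>p - 1) * (q F \<bullet> nb)) *\<^sub>R nb else 0)"
proof -
  obtain p where p: "p \<in> Q1" "\<And>x. x \<in> Tm \<Longrightarrow> \<phi> x = p x"
      "\<And>x. x \<in> Tp \<Longrightarrow> \<phi> x = ife_extension \<beta>m \<beta>p F nb p x"
    using \<phi> unfolding ife_space_def by blast
  obtain q where q: "\<And>x. (p has_derivative (\<lambda>v. v \<bullet> q x)) (at x)"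
      "\<And>k. multiaffine (\<lambda>x. q x $ k)" "continuous_on UNIV q"
    using Q1_gradient[OF p(1)] by blast
  let ?k = "(\<beta>m / \<beta>p - 1) * (q F \<bullet> nb)"
  have "ife_extension \<beta>m \<beta>p F nb p = (\<lambda>x. p x + ?k * ((x - F) \<bullet> nb))"
    by (simp add: ife_extension_def grad_within_UNIV_eqI[OF q(1)])
  then have ext: "(ife_extension \<beta>m \<beta>p F nb p has_derivative (\<lambda>v. v \<bullet> (q x + ?k *\<^sub>R nb))) (at x)" for x
    using q(1)[of x] by (auto intro!: derivative_eq_intros simp: inner_add_right)
  have "piecewise_grad Tm Tp \<phi> x = (if x \<in> Tm then q x else if x \<in> Tp then q x + ?k *\<^sub>R nb else 0)" for x
    using grad_within_relatively_open_eqI[OF Tm _ lu q(1) p(2)]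
      grad_within_relatively_open_eqI[OF Tp _ lu ext p(3)]
    by (simp add: piecewise_grad_def)
  then show thesis using q that by blast
qed

section \<open>Trace inequalities\<close>

lemma openin_cbox_imp_borel:
  fixes l u :: "real^'n"
  assumes "openin (top_of_set (cbox l u)) D"
  shows "D \<in> sets borel" "D \<subseteq> cbox l u"
proof -
  obtain W where "open W" "D = cbox l u \<inter> W" using assms by (auto simp: openin_open)
  then show "D \<in> sets borel" "D \<subseteq> cbox l u" by auto
qed

text \<open>Needed because the Bochner integral of a non-integrable function is 0, which would make lower bounds for the
  norm on the element fail.\<close>
lemma set_integrable_two_pieces:
  fixes A B :: "real^'n \<Rightarrow> 'm::euclidean_space"
  assumes AB: "continuous_on UNIV A" "continuous_on UNIV B"
    and D: "D1 \<in> sets borel" "D2 \<in> sets borel" "D1 \<subseteq> cbox l u" "D2 \<subseteq> cbox l u"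
    and H: "\<And>x. H x = (if x \<in> D1 then A x else if x \<in> D2 then B x else 0)"
  shows "set_integrable lborel (cbox l u) (\<lambda>x. (norm (H x))\<^sup>2)"
proof -
  have "integrable lborel (\<lambda>x. indicat_real D1 x *\<^sub>R (norm (A x))\<^sup>2)"
    using set_integrable_norm_power2[OF AB(1) D(1,3)] by (simp add: set_integrable_def)
  moreover have "integrable lborel (\<lambda>x. indicat_real (D2 - D1) x *\<^sub>R (norm (B x))\<^sup>2)"
    using set_integrable_norm_power2[OF AB(2), of "D2 - D1" l u] D by (auto simp: set_integrable_def)
  ultimately have "integrable lborel (\<lambda>x. indicat_real D1 x *\<^sub>R (norm (A x))\<^sup>2
      + indicat_real (D2 - D1) x *\<^sub>R (norm (B x))\<^sup>2)" by (rule Bochner_Integration.integrable_add)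
  also have "(\<lambda>x. indicat_real D1 x *\<^sub>R (norm (A x))\<^sup>2 + indicat_real (D2 - D1) x *\<^sub>R (norm (B x))\<^sup>2)
      = (\<lambda>x. indicat_real (cbox l u) x *\<^sub>R (norm (H x))\<^sup>2)"
    using D(3,4) by (auto simp: H indicator_def fun_eq_iff)
  finally show ?thesis by (simp add: set_integrable_def)
qed

lemma L2_norm_on_face_le:
  fixes w :: "real^3 \<Rightarrow> 'b::real_normed_vector"
  assumes lu: "\<And>k. l $ k \<le> u $ k" "\<And>k. u $ k - l $ k \<le> h" and c: "c \<in> {l $ i, u $ i}"
    and w: "\<And>x. x \<in> face (l, u) i c \<Longrightarrow> norm (w x) \<le> K" and K: "0 \<le> K"
  shows "L2_norm_on (plane_measure i c) (face (l, u) i c) w \<le> K * h"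
proof -
  interpret product_sigma_finite "\<lambda>_::3. lborel :: real measure" by standard
  let ?J = "UNIV - {i}" and ?F = "face (l, u) i c"
  let ?M = "Pi\<^sub>M ?J (\<lambda>_::3. lborel :: real measure)"
  let ?e = "\<lambda>y. \<chi> j. if j = i then c else y j"
  have h: "0 \<le> h" using lu(1)[of i] lu(2)[of i] by linarith
  have meas: "?e \<in> borel_measurable ?M"
  proof (rule borel_measurable_vec_lambdaI)
    fix j show "(\<lambda>y. if j = i then c else y j) \<in> borel_measurable ?M"
      by (cases "j = i") auto
  qed
  have Fc: "closed ?F"
  proof -
    have "?F = cbox l u \<inter> {x. x $ i = c}" by (auto simp: face_def element_def)
    moreover have "closed {x :: real^3. x $ i = c}" by (intro closed_Collect_eq continuous_intros)
    ultimately show ?thesis by auto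
  qed
  then have Fs: "?F \<in> sets borel" by simp
  have lc: "l $ i \<le> c" "c \<le> u $ i" using c lu(1)[of i] by auto
  have pre: "?e -` ?F \<inter> space ?M = Pi\<^sub>E ?J (\<lambda>j. {l $ j .. u $ j})"
    using lc by (auto simp: space_PiM face_def element_def mem_box_cart PiE_def Pi_def)
  have "emeasure (plane_measure i c) ?F = (\<Prod>j\<in>?J. ennreal (u $ j - l $ j))"
    unfolding plane_measure_def using lu(1) by (simp add: emeasure_distr[OF meas Fs] pre emeasure_PiM)
  also have "\<dots> = ennreal (\<Prod>j\<in>?J. u $ j - l $ j)" using lu(1) by (simp add: prod_ennreal)
  finally have em: "emeasure (plane_measure i c) ?F = ennreal (\<Prod>j\<in>?J. u $ j - l $ j)" .
  have "(\<Prod>j\<in>?J. u $ j - l $ j) \<le> (\<Prod>j\<in>?J. h)" using lu by (intro prod_mono) auto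
  then have pr: "(\<Prod>j\<in>?J. u $ j - l $ j) \<le> h\<^sup>2" by (simp add: card_Diff_singleton)
  have mF: "measure (plane_measure i c) ?F \<le> h\<^sup>2"
    using pr lu(1) by (simp add: measure_def em prod_nonneg)
  have int: "integrable (plane_measure i c) (\<lambda>x. K\<^sup>2 * indicat_real ?F x)"
  proof (intro integrable_mult_right integrable_real_indicator)
    show "?F \<in> sets (plane_measure i c)" using Fs by (simp add: plane_measure_def)
    show "emeasure (plane_measure i c) ?F < \<infinity>" by (simp add: em)
  qed
  \<comment> \<open>Domination suffices: if \<open>w\<close> is not square integrable on the face, the left-hand side is 0.\<close>
  have "(LINT x:?F|plane_measure i c. (norm (w x))\<^sup>2) \<le> (\<integral>x. K\<^sup>2 * indicat_real ?F x \<partial>plane_measure i c)"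
    unfolding set_lebesgue_integral_def
  proof (rule integral_mono'[OF int])
    fix x
    show "indicat_real ?F x *\<^sub>R (norm (w x))\<^sup>2 \<le> K\<^sup>2 * indicat_real ?F x"
      using w[of x] by (cases "x \<in> ?F") (auto intro: power_mono)
  qed (simp add: indicator_def)
  also have "\<dots> = K\<^sup>2 * measure (plane_measure i c) ?F"
    by (simp add: plane_measure_def)
  also have "\<dots> \<le> K\<^sup>2 * h\<^sup>2" using mF by (intro mult_left_mono) auto
  finally have "L2_norm_on (plane_measure i c) ?F w \<le> sqrt ((K * h)\<^sup>2)"
    unfolding L2_norm_on_def by (intro real_sqrt_le_mono) (simp add: power_mult_distrib)
  then show ?thesis using K h by simp
qed

text \<open>The factor \<open>\<sigma> ^ 3\<close> compares \<open>h ^ 3\<close> with the volume of an element; the factor 2 accounts for the two summands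
  \<open>norm (Q x)\<close> and \<open>norm (Q F)\<close> in the bound on the trace.\<close>
definition trace_const :: "real \<Rightarrow> real" where
  "trace_const \<sigma> = 2 * sqrt (remez_const 3 * \<sigma> ^ 3)"

text \<open>The common core of both inequalities. By the Remez inequality the pointwise values of the polynomial field \<open>Q\<close>, at
  points of the face as well as at \<open>F\<close>, are bounded by the norm over \<open>E\<close>, where \<open>Q\<close> coincides with \<open>H\<close>.\<close>
lemma trace_inequality_from_large_part:
  fixes Q H :: "real^3 \<Rightarrow> real^3" and w :: "real^3 \<Rightarrow> real"
  assumes \<sigma>: "1 \<le> \<sigma>"
    and lu: "\<And>k. l $ k < u $ k" "\<And>k. u $ k - l $ k \<le> h" "\<And>k. h \<le> \<sigma> * (u $ k - l $ k)"
    and c: "c \<in> {l $ i, u $ i}"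
    and Q: "\<And>k. multiaffine (\<lambda>x. Q x $ k)" "continuous_on UNIV Q"
    and E: "E \<in> sets borel" "E \<subseteq> cbox l u" "measure lborel (cbox l u) \<le> 2 * measure lborel E"
    and F: "F \<in> cbox l u"
    and H: "\<And>x. x \<in> E \<Longrightarrow> H x = Q x" "set_integrable lborel (cbox l u) (\<lambda>x. (norm (H x))\<^sup>2)"
    and w: "\<And>x. x \<in> face (l, u) i c \<Longrightarrow> \<bar>w x\<bar> \<le> norm (Q x) + norm (Q F)"
  shows "L2_norm_on (plane_measure i c) (face (l, u) i c) w
      \<le> trace_const \<sigma> * h powr (-1/2) * L2_norm_on lborel (element (l, u)) H"
proof -
  define N where "N = L2_norm_on lborel (element (l, u)) H"
  define R where "R = remez_const 3 * \<sigma> ^ 3"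
  have h: "0 < h" using lu(1)[of 1] lu(2)[of 1] by linarith
  have R: "0 \<le> R" using \<sigma> by (simp add: R_def remez_const_def)
  have intH: "integrable lborel (\<lambda>x. indicat_real (cbox l u) x *\<^sub>R (norm (H x))\<^sup>2)"
    using H(2) by (simp add: set_integrable_def)
  have N2: "N\<^sup>2 = (LINT x:cbox l u|lborel. (norm (H x))\<^sup>2)"
    unfolding N_def L2_norm_on_def element_def
    by (simp add: set_lebesgue_integral_def integral_nonneg)
  have N0: "0 \<le> N" unfolding N_def L2_norm_on_def set_lebesgue_integral_def by simp
  have "(LINT x:E|lborel. (norm (Q x))\<^sup>2) \<le> N\<^sup>2"
    unfolding N2 set_lebesgue_integral_def
  proof (rule integral_mono'[OF intH])
    fix x show "indicat_real E x *\<^sub>R (norm (Q x))\<^sup>2 \<le> indicat_real (cbox l u) x *\<^sub>R (norm (H x))\<^sup>2"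
      using E(2) H(1)[of x] by (auto simp: indicator_def)
  qed simp
  then have rem: "(norm (Q v))\<^sup>2 * measure lborel (cbox l u) \<le> remez_const 3 * N\<^sup>2" if "v \<in> cbox l u" for v
  proof -
    assume le: "(LINT x:E|lborel. (norm (Q x))\<^sup>2) \<le> N\<^sup>2"
    have "(norm (Q v))\<^sup>2 * measure lborel (cbox l u) \<le> remez_const 3 * (LINT x:E|lborel. (norm (Q x))\<^sup>2)"
      using multiaffine_field_remez_L2[OF Q that E] by simp
    also have "\<dots> \<le> remez_const 3 * N\<^sup>2"
      using le by (intro mult_left_mono) (auto simp: remez_const_def)
    finally show ?thesis .
  qed
  have vol: "h ^ 3 \<le> \<sigma> ^ 3 * measure lborel (cbox l u)"
  proof -
    have "h ^ 3 = (\<Prod>k\<in>(UNIV :: 3 set). h)" by simp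
    also have "\<dots> \<le> (\<Prod>k\<in>UNIV. \<sigma> * (u $ k - l $ k))" using h lu(3) by (intro prod_mono) auto
    also have "\<dots> = \<sigma> ^ 3 * measure lborel (cbox l u)"
      using lu(1) by (simp add: content_cbox_prod less_imp_le prod.distrib)
    finally show ?thesis .
  qed
  define K where "K = sqrt (R / h ^ 3) * N"
  have K0: "0 \<le> K" using N0 R h by (simp add: K_def)
  have QK: "norm (Q v) \<le> K" if v: "v \<in> cbox l u" for v
  proof -
    have "(norm (Q v))\<^sup>2 * h ^ 3 \<le> (norm (Q v))\<^sup>2 * (\<sigma> ^ 3 * measure lborel (cbox l u))"
      using vol by (intro mult_left_mono) auto
    also have "\<dots> = \<sigma> ^ 3 * ((norm (Q v))\<^sup>2 * measure lborel (cbox l u))" by simp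
    also have "\<dots> \<le> \<sigma> ^ 3 * (remez_const 3 * N\<^sup>2)"
      using rem[OF v] \<sigma> by (intro mult_left_mono) auto
    finally have "(norm (Q v))\<^sup>2 * h ^ 3 \<le> R * N\<^sup>2"
      by (simp only: R_def mult_ac)
    then have "(norm (Q v))\<^sup>2 \<le> R / h ^ 3 * N\<^sup>2"
      using h by (simp add: pos_le_divide_eq)
    also have "\<dots> = K\<^sup>2" using R h by (simp add: K_def power_mult_distrib)
    finally show ?thesis using K0 by (rule power2_le_imp_le)
  qed
  have "L2_norm_on (plane_measure i c) (face (l, u) i c) w \<le> (2 * K) * h"
  proof (rule L2_norm_on_face_le)
    fix x assume x: "x \<in> face (l, u) i c"
    then have "x \<in> cbox l u" by (simp add: face_def element_def)
    then show "norm (w x) \<le> 2 * K" using w[OF x] QK[of x] QK[OF F] by simp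
  qed (use lu c K0 in \<open>auto intro: less_imp_le\<close>)
  also have "(2 * K) * h = trace_const \<sigma> * (h / sqrt (h ^ 3)) * N"
    by (simp add: K_def trace_const_def R_def real_sqrt_divide)
  also have "h / sqrt (h ^ 3) = h powr (-1/2)"
  proof -
    have "h powr (3/2) = (h powr 3) powr (1/2)" by (simp add: powr_powr)
    also have "\<dots> = sqrt (h ^ 3)" using h by (simp add: powr_half_sqrt)
    finally have "h / sqrt (h ^ 3) = h powr 1 / h powr (3/2)" using h by simp
    also have "\<dots> = h powr (1 - 3/2)" by (rule powr_diff[symmetric])
    finally show ?thesis by simp
  qed
  finally show ?thesis by (simp add: N_def)
qed

text \<open>Which alternative holds is decided by the volumes of the two parts alone, hence uniformly in \<open>\<phi>\<close>: if \<open>Tm\<close> is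
  large, \<open>Q\<close> is the gradient on \<open>Tm\<close>; otherwise \<open>Q\<close> is \<open>\<beta>p\<close> times the gradient on \<open>Tp\<close>.\<close>
lemma trace_alternative:
  fixes l u :: "real^3"
  assumes \<sigma>: "1 \<le> \<sigma>"
    and lu: "\<And>k. l $ k < u $ k" "\<And>k. u $ k - l $ k \<le> h" "\<And>k. h \<le> \<sigma> * (u $ k - l $ k)"
    and \<beta>: "0 < \<beta>m" "\<beta>m \<le> \<beta>p" and F: "F \<in> cbox l u" and nb: "norm nb = 1"
    and Tm: "openin (top_of_set (cbox l u)) Tm" and Tp: "openin (top_of_set (cbox l u)) Tp"
    and cover: "measure lborel (cbox l u) \<le> measure lborel (Tm \<union> Tp)"
    and c: "c \<in> {l $ i, u $ i}" and n: "norm n = 1"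
  shows "(\<forall>\<phi>\<in>ife_space \<beta>m \<beta>p F nb Tm Tp.
        L2_norm_on (plane_measure i c) (face (l, u) i c) (\<lambda>x. piecewise_grad Tm Tp \<phi> x \<bullet> n)
        \<le> trace_const \<sigma> * h powr (-1/2) * L2_norm_on lborel (element (l, u)) (piecewise_grad Tm Tp \<phi>)) \<or>
     (\<forall>\<phi>\<in>ife_space \<beta>m \<beta>p F nb Tm Tp.
        L2_norm_on (plane_measure i c) (face (l, u) i c)
          (\<lambda>x. piecewise_const Tm Tp \<beta>m \<beta>p x * (piecewise_grad Tm Tp \<phi> x \<bullet> n))
        \<le> trace_const \<sigma> * h powr (-1/2) * L2_norm_on lborel (element (l, u))
          (\<lambda>x. piecewise_const Tm Tp \<beta>m \<beta>p x *\<^sub>R piecewise_grad Tm Tp \<phi> x))"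
    (is "(\<forall>\<phi>\<in>?S. ?a \<phi>) \<or> (\<forall>\<phi>\<in>?S. ?b \<phi>)")
proof -
  note Tms = openin_cbox_imp_borel[OF Tm] and Tps = openin_cbox_imp_borel[OF Tp]
  define V where "V = measure lborel (cbox l u)"
  define \<rho> where "\<rho> = \<beta>m / \<beta>p"
  have \<rho>: "0 < \<rho>" "\<rho> \<le> 1" "\<rho> * \<beta>p = \<beta>m" using \<beta> by (auto simp: \<rho>_def)
  have inn: "\<bar>v \<bullet> w\<bar> \<le> norm v" if "norm w = 1" for v w :: "real^3"
    using Cauchy_Schwarz_ineq2[of v w] that by simp
  have fm: "D \<in> fmeasurable lborel" if "D \<in> sets borel" "D \<subseteq> cbox l u" for D :: "(real^3) set"
    by (rule fmeasurableI2[OF fmeasurable_cbox that(2)]) (use that in simp)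
  \<comment> \<open>\<open>Tp - Tm\<close> is where the piecewise gradient takes the value from \<open>Tp\<close>, as \<open>Tm\<close> has precedence in its definition.\<close>
  have "Tm \<union> Tp = Tm \<union> (Tp - Tm)" by blast
  then have "V \<le> measure lborel Tm + measure lborel (Tp - Tm)"
    using cover measure_Un_le[of Tm lborel "Tp - Tm"] Tms Tps by (simp add: V_def)
  then consider "V \<le> 2 * measure lborel Tm" | "V \<le> 2 * measure lborel (Tp - Tm)" by linarith
  then show ?thesis
  proof cases
    case 1
    have "?a \<phi>" if \<phi>: "\<phi> \<in> ?S" for \<phi>
    proof -
      obtain q where q: "\<And>k. multiaffine (\<lambda>x. q x $ k)" "continuous_on UNIV q"
        and G: "\<And>x. piecewise_grad Tm Tp \<phi> x = (if x \<in> Tm then q x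
            else if x \<in> Tp then q x + ((\<beta>m / \<beta>p - 1) * (q F \<bullet> nb)) *\<^sub>R nb else 0)"
        using ife_space_piecewise_grad[OF Tm Tp lu(1) \<phi>] by blast
      have k: "norm (((\<rho> - 1) * (q F \<bullet> nb)) *\<^sub>R nb) \<le> norm (q F)"
      proof -
        have "\<bar>\<rho> - 1\<bar> * \<bar>q F \<bullet> nb\<bar> \<le> 1 * norm (q F)"
          using \<rho> inn[OF nb] by (intro mult_mono) auto
        then show ?thesis by (simp add: nb abs_mult)
      qed
      show ?thesis
      proof (rule trace_inequality_from_large_part[OF \<sigma> lu c q Tms 1[unfolded V_def] F])
        show "set_integrable lborel (cbox l u) (\<lambda>x. (norm (piecewise_grad Tm Tp \<phi> x))\<^sup>2)"
          by (rule set_integrable_two_pieces[OF q(2) _ Tms(1) Tps(1) Tms(2) Tps(2) G])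
             (intro continuous_intros q(2))
        fix x assume "x \<in> face (l, u) i c"
        have "norm (piecewise_grad Tm Tp \<phi> x) \<le> norm (q x) + norm (q F)"
          using k norm_triangle_ineq[of "q x" "((\<rho> - 1) * (q F \<bullet> nb)) *\<^sub>R nb"] by (simp add: G \<rho>_def)
        then show "\<bar>piecewise_grad Tm Tp \<phi> x \<bullet> n\<bar> \<le> norm (q x) + norm (q F)"
          using inn[OF n] order_trans by blast
      qed (simp add: G)
    qed
    then show ?thesis by blast
  next
    case 2
    have "?b \<phi>" if \<phi>: "\<phi> \<in> ?S" for \<phi>
    proof -
      obtain q where q: "\<And>k. multiaffine (\<lambda>x. q x $ k)" "continuous_on UNIV q"
        and G: "\<And>x. piecewise_grad Tm Tp \<phi> x = (if x \<in> Tm then q x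
            else if x \<in> Tp then q x + ((\<beta>m / \<beta>p - 1) * (q F \<bullet> nb)) *\<^sub>R nb else 0)"
        using ife_space_piecewise_grad[OF Tm Tp lu(1) \<phi>] by blast
      define d where "d = ((\<rho> - 1) * (q F \<bullet> nb)) *\<^sub>R nb"
      define Q where "Q x = \<beta>p *\<^sub>R (q x + d)" for x
      let ?H = "\<lambda>x. piecewise_const Tm Tp \<beta>m \<beta>p x *\<^sub>R piecewise_grad Tm Tp \<phi> x"
      have H: "?H x = (if x \<in> Tm then \<beta>m *\<^sub>R q x else if x \<in> Tp then Q x else 0)" for x
        by (simp add: G Q_def d_def \<rho>_def piecewise_const_def)
      have Q: "\<And>k. multiaffine (\<lambda>x. Q x $ k)" "continuous_on UNIV Q"
        unfolding Q_def using multiaffine_scale_shift[OF q(1)] q(2)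
        by (auto intro!: continuous_intros)
      \<comment> \<open>The flux is continuous at \<open>F\<close>; this is what turns the jump of the gradient, of size
        \<open>1 / \<rho>\<close> relative to the gradient on \<open>Tp\<close>, into one that is bounded after weighting with the coefficient.\<close>
      have QF: "Q F \<bullet> nb = \<beta>m * (q F \<bullet> nb)"
      proof -
        have "nb \<bullet> nb = 1" using nb by (simp add: norm_eq_1)
        then have "(q F + d) \<bullet> nb = \<rho> * (q F \<bullet> nb)" by (simp add: d_def inner_add_left algebra_simps)
        then show ?thesis using \<rho>(3) by (simp add: Q_def mult.commute)
      qed
      have d: "norm (\<beta>m *\<^sub>R d) \<le> norm (Q F)"
      proof -
        have "norm (\<beta>m *\<^sub>R d) = \<bar>\<rho> - 1\<bar> * \<bar>Q F \<bullet> nb\<bar>"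
          unfolding QF using \<beta> by (simp add: d_def nb abs_mult)
        also have "\<dots> \<le> 1 * norm (Q F)" using \<rho> inn[OF nb] by (intro mult_mono) auto
        finally show ?thesis by simp
      qed
      have minus: "norm (\<beta>m *\<^sub>R q x) \<le> norm (Q x) + norm (Q F)" for x
      proof -
        have "\<beta>m *\<^sub>R q x = \<rho> *\<^sub>R Q x - \<beta>m *\<^sub>R d"
          using \<rho>(3) by (simp add: Q_def scaleR_add_right)
        then have "norm (\<beta>m *\<^sub>R q x) \<le> norm (\<rho> *\<^sub>R Q x) + norm (\<beta>m *\<^sub>R d)"
          by (simp only: norm_triangle_ineq4)
        moreover have "norm (\<rho> *\<^sub>R Q x) \<le> norm (Q x)"
          using \<rho> by (simp add: mult_left_le_one_le)
        ultimately show ?thesis using d by linarith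
      qed
      show ?thesis
      proof (rule trace_inequality_from_large_part[OF \<sigma> lu c Q _ _ 2[unfolded V_def] F])
        show "set_integrable lborel (cbox l u) (\<lambda>x. (norm (?H x))\<^sup>2)"
          by (rule set_integrable_two_pieces[OF _ Q(2) Tms(1) Tps(1) Tms(2) Tps(2) H])
             (intro continuous_intros q(2))
        fix x assume "x \<in> face (l, u) i c"
        have "norm (?H x) \<le> norm (Q x) + norm (Q F)"
          using minus[of x] by (simp add: H)
        then have "\<bar>?H x \<bullet> n\<bar> \<le> norm (Q x) + norm (Q F)" using inn[OF n] order_trans by blast
        then show "\<bar>piecewise_const Tm Tp \<beta>m \<beta>p x * (piecewise_grad Tm Tp \<phi> x \<bullet> n)\<bar> \<le> norm (Q x) + norm (Q F)"
          by simp
      qed (use H Tms Tps in auto)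
    qed
    then show ?thesis by blast
  qed
qed

theorem theorem4p5:
  fixes \<sigma> :: real
  assumes "\<sigma> \<ge> 1"
  shows "\<exists>C>0. \<forall>(a :: real^3) b \<Gamma> \<Omega>m \<Omega>p \<beta>m \<beta>p \<T> h.
    (\<forall>i. a $ i < b $ i) \<and> closed_C2_surface \<Gamma> \<and> separates \<Gamma> (box a b) \<Omega>m \<Omega>p \<and>
    0 < \<beta>m \<and> \<beta>m \<le> \<beta>p \<and>
    cartesian_mesh a b \<T> \<and> h = mesh_size \<T> \<and>
    (\<forall>(l, u)\<in>\<T>. \<forall>i. h \<le> \<sigma> * (u $ i - l $ i)) \<and>
    h < surface_reach \<Gamma> / (3 * sqrt 3) \<and> h * max_curvature \<Gamma> \<le> 0.0288 \<and>
    edge_face_condition \<Gamma> \<T>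
    \<longrightarrow>
    (\<forall>T\<in>interface_elements \<Gamma> \<Omega>m \<Omega>p \<T>. \<forall>P Q R nb.
      admissible_triangle \<Gamma> T P Q R \<and> unit_normal_to (affine hull {P, Q, R}) nb \<longrightarrow>
      (let Tm = subelement \<Gamma> \<Omega>m T; Tp = subelement \<Gamma> \<Omega>p T;
           S = ife_space \<beta>m \<beta>p (centroid P Q R) nb Tm Tp;
           \<beta> = piecewise_const Tm Tp \<beta>m \<beta>p;
           Grad = piecewise_grad Tm Tp
       in \<forall>(i, c)\<in>face_indices T. \<forall>n. unit_normal_to (face T i c) n \<longrightarrow>
         (\<forall>\<phi>\<in>S. L2_norm_on (plane_measure i c) (face T i c) (\<lambda>x. Grad \<phi> x \<bullet> n)
               \<le> C * h powr (-1/2) * L2_norm_on lborel (element T) (Grad \<phi>)) \<or>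
         (\<forall>\<phi>\<in>S. L2_norm_on (plane_measure i c) (face T i c) (\<lambda>x. \<beta> x * (Grad \<phi> x \<bullet> n))
               \<le> C * h powr (-1/2) * L2_norm_on lborel (element T) (\<lambda>x. \<beta> x *\<^sub>R Grad \<phi> x))))"
proof (intro exI[of _ "trace_const \<sigma>"] conjI allI impI ballI)
  show "0 < trace_const \<sigma>" using assms by (simp add: trace_const_def remez_const_def)
next
  fix a b :: "real^3" and \<Gamma> \<Omega>m \<Omega>p :: "(real^3) set" and \<beta>m \<beta>p h :: real and \<T> :: "cuboid set"
    and T :: cuboid and P Q R nb :: "real^3"
  assume *: "(\<forall>i. a $ i < b $ i) \<and> closed_C2_surface \<Gamma> \<and> separates \<Gamma> (box a b) \<Omega>m \<Omega>p \<and>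
    0 < \<beta>m \<and> \<beta>m \<le> \<beta>p \<and>
    cartesian_mesh a b \<T> \<and> h = mesh_size \<T> \<and>
    (\<forall>(l, u)\<in>\<T>. \<forall>i. h \<le> \<sigma> * (u $ i - l $ i)) \<and>
    h < surface_reach \<Gamma> / (3 * sqrt 3) \<and> h * max_curvature \<Gamma> \<le> 0.0288 \<and>
    edge_face_condition \<Gamma> \<T>"
    and "T \<in> interface_elements \<Gamma> \<Omega>m \<Omega>p \<T>"
    and tri: "admissible_triangle \<Gamma> T P Q R \<and> unit_normal_to (affine hull {P, Q, R}) nb"
  obtain l u where Tlu: "T = (l, u)" by (cases T)
  have T: "(l, u) \<in> \<T>" using \<open>T \<in> interface_elements \<Gamma> \<Omega>m \<Omega>p \<T>\<close>
    by (simp add: Tlu interface_elements_def)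
  have \<Gamma>: "closed_C2_surface \<Gamma>" and sep: "separates \<Gamma> (box a b) \<Omega>m \<Omega>p"
    and \<beta>: "0 < \<beta>m" "\<beta>m \<le> \<beta>p" and mesh: "cartesian_mesh a b \<T>" and h: "h = mesh_size \<T>"
    and shape: "\<And>k. h \<le> \<sigma> * (u $ k - l $ k)"
    using * T by auto
  note lu = cartesian_mesh_element[OF mesh T]
  have ne: "box a b \<noteq> {}" using * by (simp add: interval_ne_empty_cart)
  have cl: "closed \<Gamma>" using \<Gamma> by (auto simp: closed_C2_surface_def compact_imp_closed)
  have F: "centroid P Q R \<in> cbox l u"
    using centroid_in_element[of \<Gamma> l u P Q R] tri lu(1) by (simp add: Tlu less_imp_le)
  have nb: "norm nb = 1" using tri by (simp add: unit_normal_to_def)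
  have om: "openin (top_of_set (cbox l u)) (subelement \<Gamma> \<Omega>m T)"
    and op: "openin (top_of_set (cbox l u)) (subelement \<Gamma> \<Omega>p T)"
    using openin_closed_side[of \<Omega>m \<Omega>p a b \<Gamma> "cbox l u"] openin_closed_side[of \<Omega>p \<Omega>m a b \<Gamma> "cbox l u"]
      sep cl ne lu(3) by (simp_all add: separates_def subelement_def element_def Tlu Int_commute Un_commute)
  have cover: "measure lborel (cbox l u) \<le> measure lborel (subelement \<Gamma> \<Omega>m T \<union> subelement \<Gamma> \<Omega>p T)"
    unfolding Tlu
    by (rule measure_subelements_cover[OF sep \<Gamma> ne lu(3)])
       (use om op in \<open>auto simp: Tlu dest: openin_cbox_imp_borel(1)\<close>)
  show "let Tm = subelement \<Gamma> \<Omega>m T; Tp = subelement \<Gamma> \<Omega>p T;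
           S = ife_space \<beta>m \<beta>p (centroid P Q R) nb Tm Tp;
           \<beta> = piecewise_const Tm Tp \<beta>m \<beta>p;
           Grad = piecewise_grad Tm Tp
       in \<forall>(i, c)\<in>face_indices T. \<forall>n. unit_normal_to (face T i c) n \<longrightarrow>
         (\<forall>\<phi>\<in>S. L2_norm_on (plane_measure i c) (face T i c) (\<lambda>x. Grad \<phi> x \<bullet> n)
               \<le> trace_const \<sigma> * h powr (-1/2) * L2_norm_on lborel (element T) (Grad \<phi>)) \<or>
         (\<forall>\<phi>\<in>S. L2_norm_on (plane_measure i c) (face T i c) (\<lambda>x. \<beta> x * (Grad \<phi> x \<bullet> n))
               \<le> trace_const \<sigma> * h powr (-1/2) * L2_norm_on lborel (element T) (\<lambda>x. \<beta> x *\<^sub>R Grad \<phi> x))"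
    unfolding Let_def
  proof (clarify, goal_cases)
    case (1 i c n)
    then have "c \<in> {l $ i, u $ i}" "norm n = 1"
      by (auto simp: face_indices_def unit_normal_to_def Tlu)
    from trace_alternative[OF assms lu(1) lu(2)[folded h] shape \<beta> F nb om op cover this]
    show ?case using 1 unfolding Tlu by blast
  qed
qed

end
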